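(* Let $n\in\mathbb{N}$ and let $\mathbf w=(w_1,\dots,w_n)\in(\mathbb{Q}\cap(0,1))^n$ be the normalized weight system of a quasihomogeneous singularity, i.e. satisfying condition $(C1)$. Write $w_j=s_j/t_j$ with $\gcd(s_j,t_j)=1$, $D_{\mathbf w}=\prod_{j=1}^n\left(\frac1{s_j}\Lambda_{t_j}-\Lambda_1\right)=\sum_{m\in\mathbb{N}}\nu(m)\Psi_m$ (with $\nu(m)\in\mathbb{N}_0$), $\nu_{max}=\max_m\nu(m)$, and $M_j=\{m\in\mathbb{N}\mid\nu(m)\ge j\}$ for $j=1,\dots,\nu_{max}$. Suppose that one of the following holds: (i) $\mathbf w$ is of cycle type; (ii) $\mathbf w$ is of chain type; (iii) $n=2$; (iv) $n=3$ and $\mathbf w$ is of type III, IV, V, VI or VII. Then each of the sets $M_1,\dots,M_{\nu_{max}}$ satisfies condition (I). In fact, each $M_j$ satisfies the stronger conditions: (1) $M_j$ contains a largest number $m_1$ and every vertex of $\mathcal{G}(M_j)$ can be reached from $m_1$ by a directed path; (2) there is a directed path in $\mathcal{G}(M_j)$ consisting only of $2$-edges which contains a vertex of every $2$-plane of $\mathcal{G}(M_j)$.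
   Context: Condition $(C1)$ for $\mathbf w$, with $N=\{1,\dots,n\}$: for every nonempty $J\subset N$, either there is $\alpha\in\mathbb{N}_0^n$ with $\alpha_i=0$ for $i\notin J$ and $\sum_i\alpha_iw_i=1$, or there is $K\subset N\setminus J$ with $|K|=|J|$ such that for each $k\in K$ there is $\alpha\in\mathbb{N}_0^n$ with $\alpha_i=0$ for $i\notin J$ and $\sum_i\alpha_iw_i=1-w_k$. (This is equivalent to the existence of a quasihomogeneous polynomial of these weights with an isolated singularity at $0$; then $D_{\mathbf w}$ is the divisor of the characteristic polynomial of the monodromy, whence $\nu(m)\in\mathbb{N}_0$ and the $M_j$ are the supports of its elementary divisors.) Here $\mathbb{Q}\langle S^{UR}\rangle$ is the group ring over $\mathbb{Q}$ of the group of roots of unity, $\Lambda_m=\sum_{a=0}^{m-1}\langle e^{2\pi ia/m}\rangle$, $\Psi_m=\sum_{\zeta\text{ of order }m}\langle\zeta\rangle$. Types (all up to permutation of the variables, with $a_j\in\mathbb{N}$): cycle type: $a_jw_j+w_{j-1}=1$ for all $j$ with $w_0:=w_n$; chain type: $a_1w_1=1$ and $a_jw_j+w_{j-1}=1$ for $j=2,\dots,n$. For $n=3$: type III: $a_1w_1=1$, $a_2w_2+w_1=1$, $a_3w_3+w_1=1$; type IV: $a_1w_1=1$, $a_2w_2+w_3=1$, $a_3w_3+w_2=1$; type V: chain type; type VI: $a_1w_1+w_2=1$, $a_2w_2+w_1=1$, $a_3w_3+w_1=1$; type VII: cycle type. Graph: for finite $M\subset\mathbb{N}$, $\mathcal{G}(M)$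 has vertex set $M$ and a directed edge from $m_1$ to $m_2$ (a $p$-edge) iff $m_1/m_2=p^e$ for a prime $p$, $e\ge1$, and no $m_3\in M\setminus\{m_1,m_2\}$ satisfies $m_2\mid m_3\mid m_1$. The $p$-planes are the connected components after deleting all $p$-edges; a highest $p$-plane is one at none of whose vertices a $p$-edge ends; a highest $p$-edge is a $p$-edge from $m_1$ to $m_2$ such that no $p$-edge ends at $m_1$. Condition (I): $\mathcal{G}(M)$ is connected; the graph obtained from $\mathcal{G}(M)$ by deleting all highest $2$-edges has only one or two connected components; and for every prime $p\ge3$, $\mathcal{G}(M)$ has only one highest $p$-plane. *)

theory Defs
  imports Complex_Main "HOL-Computational_Algebra.Primes"
begin

section \<open>Weight systems\<close>

text \<open>Weights are indexed by 1..n: w :: nat => rat, only w 1, ..., w n matter.\<close>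

definition weight_system :: "nat \<Rightarrow> (nat \<Rightarrow> rat) \<Rightarrow> bool" where
  "weight_system n w \<longleftrightarrow> n \<ge> 1 \<and> (\<forall>i\<in>{1..n}. 0 < w i \<and> w i < 1)"

definition wsum :: "nat \<Rightarrow> (nat \<Rightarrow> rat) \<Rightarrow> (nat \<Rightarrow> nat) \<Rightarrow> rat" where
  "wsum n w \<alpha> = (\<Sum>i\<in>{1..n}. of_nat (\<alpha> i) * w i)"

text \<open>Condition (C1).\<close>
definition C1 :: "nat \<Rightarrow> (nat \<Rightarrow> rat) \<Rightarrow> bool" where
  "C1 n w \<longleftrightarrow> (\<forall>J. J \<subseteq> {1..n} \<and> J \<noteq> {} \<longrightarrow>
      (\<exists>\<alpha>::nat\<Rightarrow>nat. (\<forall>i. i \<notin> J \<longrightarrow> \<alpha> i = 0) \<and> wsum n w \<alpha> = 1)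
    \<or> (\<exists>K. K \<subseteq> {1..n} - J \<and> card K = card J \<and>
          (\<forall>k\<in>K. \<exists>\<alpha>::nat\<Rightarrow>nat. (\<forall>i. i \<notin> J \<longrightarrow> \<alpha> i = 0) \<and> wsum n w \<alpha> = 1 - w k)))"

section \<open>The group ring Q<S^UR> (finitely supported functions from roots of unity to Q)\<close>

text \<open>Roots of unity are complex numbers; an element of the group ring is a
  finitely supported function complex => rat (value at a root = its coefficient).\<close>

definition gr_mult :: "(complex \<Rightarrow> rat) \<Rightarrow> (complex \<Rightarrow> rat) \<Rightarrow> (complex \<Rightarrow> rat)" where
  "gr_mult f g = (\<lambda>z. \<Sum>(x,y)\<in>{(x,y). f x \<noteq> 0 \<and> g y \<noteq> 0 \<and> x * y = z}. f x * g y)"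

definition gr_one :: "complex \<Rightarrow> rat" where
  "gr_one = (\<lambda>z. if z = 1 then 1 else 0)"

text \<open>Lambda_m = sum_{a=0}^{m-1} <e^{2 pi i a/m}>\<close>
definition Lambda :: "nat \<Rightarrow> complex \<Rightarrow> rat" where
  "Lambda m = (\<lambda>z. if z \<in> {cis (2 * pi * real a / real m) | a. a < m} then 1 else 0)"

text \<open>Psi_m = sum of <zeta> over the roots of unity zeta of order m\<close>
definition Psi :: "nat \<Rightarrow> complex \<Rightarrow> rat" where
  "Psi m = (\<lambda>z. if z ^ m = 1 \<and> (\<forall>k. 0 < k \<longrightarrow> k < m \<longrightarrow> z ^ k \<noteq> 1) then 1 else 0)"

text \<open>w_j = s_j / t_j in lowest terms\<close>
definition wnum :: "rat \<Rightarrow> int" where "wnum q = fst (quotient_of q)"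
definition wden :: "rat \<Rightarrow> int" where "wden q = snd (quotient_of q)"

definition Dfactor :: "(nat \<Rightarrow> rat) \<Rightarrow> nat \<Rightarrow> complex \<Rightarrow> rat" where
  "Dfactor w j = (\<lambda>z. Lambda (nat (wden (w j))) z / of_int (wnum (w j)) - Lambda 1 z)"

text \<open>D_w restricted to first k factors; D_w = Dprod w n\<close>
fun Dprod :: "(nat \<Rightarrow> rat) \<Rightarrow> nat \<Rightarrow> complex \<Rightarrow> rat" where
  "Dprod w 0 = gr_one"
| "Dprod w (Suc k) = gr_mult (Dprod w k) (Dfactor w (Suc k))"

text \<open>nu(m): coefficient of Psi_m in D_w = sum_m nu(m) Psi_m, i.e. the common
  coefficient of D_w at the roots of order m, read off at e^{2 pi i/m}.\<close>
definition nu :: "nat \<Rightarrow> (nat \<Rightarrow> rat) \<Rightarrow> nat \<Rightarrow> rat" where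
  "nu n w m = Dprod w n (cis (2 * pi / real m))"

text \<open>nu_max = max_m nu(m) (the set of values is finite since D_w has finite support)\<close>
definition nu_max :: "nat \<Rightarrow> (nat \<Rightarrow> rat) \<Rightarrow> rat" where
  "nu_max n w = Max {nu n w m | m. m \<ge> 1}"

definition Mset :: "nat \<Rightarrow> (nat \<Rightarrow> rat) \<Rightarrow> nat \<Rightarrow> nat set" where
  "Mset n w j = {m. m \<ge> 1 \<and> nu n w m \<ge> of_nat j}"

section \<open>Types of weight systems (up to permutation of the variables)\<close>

definition up_to_perm :: "nat \<Rightarrow> (nat \<Rightarrow> rat) \<Rightarrow> ((nat \<Rightarrow> rat) \<Rightarrow> (nat \<Rightarrow> nat) \<Rightarrow> bool) \<Rightarrow> bool" where
  "up_to_perm n w P \<longleftrightarrow> (\<exists>\<sigma>. bij_betw \<sigma> {1..n} {1..n} \<and>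
      (\<exists>a::nat\<Rightarrow>nat. (\<forall>j\<in>{1..n}. a j \<ge> 1) \<and> P (w \<circ> \<sigma>) a))"

definition cycle_type :: "nat \<Rightarrow> (nat \<Rightarrow> rat) \<Rightarrow> bool" where
  "cycle_type n w \<longleftrightarrow> up_to_perm n w (\<lambda>v a.
      \<forall>j\<in>{1..n}. of_nat (a j) * v j + v (if j = 1 then n else j - 1) = 1)"

definition chain_type :: "nat \<Rightarrow> (nat \<Rightarrow> rat) \<Rightarrow> bool" where
  "chain_type n w \<longleftrightarrow> up_to_perm n w (\<lambda>v a.
      of_nat (a 1) * v 1 = 1 \<and> (\<forall>j\<in>{2..n}. of_nat (a j) * v j + v (j - 1) = 1))"

definition typeIII :: "(nat \<Rightarrow> rat) \<Rightarrow> bool" where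
  "typeIII w \<longleftrightarrow> up_to_perm 3 w (\<lambda>v a.
      of_nat (a 1) * v 1 = 1 \<and> of_nat (a 2) * v 2 + v 1 = 1 \<and> of_nat (a 3) * v 3 + v 1 = 1)"

definition typeIV :: "(nat \<Rightarrow> rat) \<Rightarrow> bool" where
  "typeIV w \<longleftrightarrow> up_to_perm 3 w (\<lambda>v a.
      of_nat (a 1) * v 1 = 1 \<and> of_nat (a 2) * v 2 + v 3 = 1 \<and> of_nat (a 3) * v 3 + v 2 = 1)"

definition typeV :: "(nat \<Rightarrow> rat) \<Rightarrow> bool" where
  "typeV w \<longleftrightarrow> chain_type 3 w"

definition typeVI :: "(nat \<Rightarrow> rat) \<Rightarrow> bool" where
  "typeVI w \<longleftrightarrow> up_to_perm 3 w (\<lambda>v a.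
      of_nat (a 1) * v 1 + v 2 = 1 \<and> of_nat (a 2) * v 2 + v 1 = 1 \<and> of_nat (a 3) * v 3 + v 1 = 1)"

definition typeVII :: "(nat \<Rightarrow> rat) \<Rightarrow> bool" where
  "typeVII w \<longleftrightarrow> cycle_type 3 w"

section \<open>The graph G(M)\<close>

definition pedge :: "nat set \<Rightarrow> nat \<Rightarrow> nat \<Rightarrow> nat \<Rightarrow> bool" where
  "pedge M p m1 m2 \<longleftrightarrow> m1 \<in> M \<and> m2 \<in> M \<and> prime p \<and> (\<exists>e\<ge>1. m1 = m2 * p ^ e) \<and>
     \<not> (\<exists>m3 \<in> M - {m1, m2}. m2 dvd m3 \<and> m3 dvd m1)"

definition gedge :: "nat set \<Rightarrow> nat \<Rightarrow> nat \<Rightarrow> bool" where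
  "gedge M m1 m2 \<longleftrightarrow> (\<exists>p. pedge M p m1 m2)"

text \<open>undirected connectivity w.r.t. a set of directed edges E\<close>
definition uconn :: "(nat \<Rightarrow> nat \<Rightarrow> bool) \<Rightarrow> nat \<Rightarrow> nat \<Rightarrow> bool" where
  "uconn E a b \<longleftrightarrow> (a, b) \<in> {(x, y). E x y \<or> E y x}\<^sup>*"

definition graph_connected :: "nat set \<Rightarrow> bool" where
  "graph_connected M \<longleftrightarrow> (\<forall>a\<in>M. \<forall>b\<in>M. uconn (gedge M) a b)"

definition highest_pedge :: "nat set \<Rightarrow> nat \<Rightarrow> nat \<Rightarrow> nat \<Rightarrow> bool" where
  "highest_pedge M p m1 m2 \<longleftrightarrow> pedge M p m1 m2 \<and> \<not> (\<exists>m0. pedge M p m0 m1)"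

text \<open>graph with all highest 2-edges deleted has one or two connected components\<close>
definition at_most_two_components_without_highest_2edges :: "nat set \<Rightarrow> bool" where
  "at_most_two_components_without_highest_2edges M \<longleftrightarrow>
     (let E = (\<lambda>x y. gedge M x y \<and> \<not> highest_pedge M 2 x y) in
      \<exists>a\<in>M. \<exists>b\<in>M. \<forall>c\<in>M. uconn E c a \<or> uconn E c b)"

text \<open>p-planes: connected components of G(M) after deleting all p-edges\<close>
definition pplane :: "nat set \<Rightarrow> nat \<Rightarrow> nat set \<Rightarrow> bool" where
  "pplane M p C \<longleftrightarrow> (\<exists>v\<in>M. C = {u\<in>M. uconn (\<lambda>x y. gedge M x y \<and> \<not> pedge M p x y) v u})"

definition highest_pplane :: "nat set \<Rightarrow> nat \<Rightarrow> nat set \<Rightarrow> bool" where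
  "highest_pplane M p C \<longleftrightarrow> pplane M p C \<and> (\<forall>v\<in>C. \<not> (\<exists>u. pedge M p u v))"

text \<open>Condition (I)\<close>
definition condI :: "nat set \<Rightarrow> bool" where
  "condI M \<longleftrightarrow> graph_connected M \<and> at_most_two_components_without_highest_2edges M \<and>
     (\<forall>p. prime p \<and> p \<ge> 3 \<longrightarrow> (\<exists>!C. highest_pplane M p C))"

text \<open>Stronger condition (1)\<close>
definition strong1 :: "nat set \<Rightarrow> bool" where
  "strong1 M \<longleftrightarrow> (\<exists>m1\<in>M. (\<forall>m\<in>M. m \<le> m1) \<and>
      (\<forall>v\<in>M. (m1, v) \<in> {(x, y). gedge M x y}\<^sup>*))"

text \<open>Stronger condition (2): a directed path (nonempty vertex list) of 2-edges
  meeting every 2-plane\<close>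
definition strong2 :: "nat set \<Rightarrow> bool" where
  "strong2 M \<longleftrightarrow> (\<exists>xs. xs \<noteq> [] \<and> set xs \<subseteq> M \<and>
      (\<forall>i. Suc i < length xs \<longrightarrow> pedge M 2 (xs ! i) (xs ! Suc i)) \<and>
      (\<forall>C. pplane M 2 C \<longrightarrow> (\<exists>x\<in>set xs. x \<in> C)))"

end

theory Submission
  imports Defs
begin

text \<open>
  A product of factors of the form \<open>\<Lambda>\<^sub>t / s - \<Lambda>\<^sub>1\<close> expands into a sum over subsets
  A of the variables, in which the subset A contributes a multiple of \<open>\<Lambda>\<^sub>l\<close> with \<open>l\<close> the
  least common multiple of the denominators in A. Hence \<open>\<nu>(m)\<close> depends only on which of finitely
  many numbers \<open>m\<close> divides. For the types in question almost all of these least common multiples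
  coincide, and the superlevel sets of \<open>\<nu>\<close> come out as a top layer, closed under passing to larger
  divisors of some \<open>t\<close>, or as \<open>Div(t) - Div(d)\<close> together with a set of the same kind inside
  \<open>Div(d)\<close>. For the chain type this is the two-step recursion
  \<open>\<nu>\<^sub>k\<^sub>+\<^sub>2 = g\<^sub>k\<^sub>+\<^sub>2[m | t\<^sub>k\<^sub>+\<^sub>2] - g\<^sub>k\<^sub>+\<^sub>1[m | t\<^sub>k\<^sub>+\<^sub>1] + \<nu>\<^sub>k\<close> with monotone \<open>g\<close>.

  In such a layered set every element reaches the top layer by multiplication with a power of a single
  prime, and elements of M that differ by a prime power are joined by a path of edges for that prime.
  If the prime can be taken odd, all 2-planes meet the odd part of \<open>t\<close> times the powers of 2; otherwise
  \<open>t/d\<close> is a power of 2 and the odd part that serves \<open>Div(d)\<close> serves the top layer as well.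
\<close>

section \<open>Graphs of layered divisor sets\<close>

lemma uconn_refl: "uconn E a a"
  by (simp add: uconn_def)

lemma uconn_sym: "uconn E a b \<Longrightarrow> uconn E b a"
proof -
  have "sym ({(x, y). E x y \<or> E y x}\<^sup>*)"
    by (intro sym_rtrancl) (auto simp: sym_def)
  then show "uconn E a b \<Longrightarrow> uconn E b a"
    unfolding uconn_def by (meson symD)
qed

lemma uconn_trans: "uconn E a b \<Longrightarrow> uconn E b c \<Longrightarrow> uconn E a c"
  unfolding uconn_def by (rule rtrancl_trans)

lemma uconn_edge: "E a b \<Longrightarrow> uconn E a b"
  unfolding uconn_def by auto

lemma uconn_mono:
  assumes "uconn E a b" and "\<And>x y. E x y \<Longrightarrow> F x y"
  shows "uconn F a b"
proof -
  have "{(x, y). E x y \<or> E y x} \<subseteq> {(x, y). F x y \<or> F y x}"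
    using assms(2) by auto
  then show ?thesis
    using assms(1) rtrancl_mono unfolding uconn_def by blast
qed

lemma uconn_of_rtrancl:
  assumes "(a, b) \<in> {(x, y). E x y}\<^sup>*"
  shows "uconn E a b"
proof -
  have "{(x, y). E x y} \<subseteq> {(x, y). E x y \<or> E y x}" by auto
  then show ?thesis
    using assms rtrancl_mono unfolding uconn_def by blast
qed

lemma uconn_invariant:
  assumes "uconn E a b" and "\<And>x y. E x y \<Longrightarrow> f x = f y"
  shows "f a = f b"
  using assms(1) unfolding uconn_def
  by (induction rule: rtrancl_induct) (use assms(2) in auto)

text \<open>Look at the last \<open>F\<close>-edge of the path, if there is one. With the p-edges as
  \<open>F\<close> this says that the p-plane of the end point is that of the start or is entered by
  a p-edge.\<close>

lemma rtrancl_enters: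
  assumes "(a, v) \<in> {(x, y). E x y}\<^sup>*"
  shows "uconn (\<lambda>x y. E x y \<and> \<not> F x y) a v \<or>
         (\<exists>u w. F u w \<and> uconn (\<lambda>x y. E x y \<and> \<not> F x y) w v)"
  using assms
proof (induction rule: rtrancl_induct)
  case base
  then show ?case by (simp add: uconn_refl)
next
  case (step y z)
  show ?case
  proof (cases "F y z")
    case True
    then show ?thesis using uconn_refl[of _ z] by blast
  next
    case False
    then have "uconn (\<lambda>x y. E x y \<and> \<not> F x y) y z"
      using step.hyps(2) by (auto intro: uconn_edge)
    then show ?thesis using step.IH uconn_trans[of _ _ y z] by blast
  qed
qed

section \<open>p-edges, p-adic valuations, and condition (I) from the two strong conditions\<close>

lemma pedge_prime_unique:
  assumes "pedge M p x y" "pedge M q x y" "0 \<notin> M"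
  shows "p = q"
proof -
  obtain e where e: "e \<ge> 1" "x = y * p ^ e" using assms(1) unfolding pedge_def by blast
  obtain f where f: "f \<ge> 1" "x = y * q ^ f" using assms(2) unfolding pedge_def by blast
  have "y \<in> M" using assms(1) unfolding pedge_def by blast
  then have "y \<noteq> 0" using assms(3) by metis
  then have "p ^ e = q ^ f" using e f by simp
  then have "p dvd q ^ f" using e(1) by (metis dvd_power not_one_le_zero not_gr_zero)
  then show ?thesis
    using assms(1,2) unfolding pedge_def
    by (meson prime_dvd_power primes_dvd_imp_eq)
qed

text \<open>This makes the p-adic valuation constant on every p-plane.\<close>

lemma multiplicity_pedge_other:
  assumes "pedge M q x y" "prime p" "q \<noteq> p" "0 \<notin> M"
  shows "multiplicity p x = multiplicity p y"
proof -
  obtain e where e: "x = y * q ^ e" and q: "prime q" and "y \<in> M"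
    using assms(1) unfolding pedge_def by blast
  have "y \<noteq> 0" using \<open>y \<in> M\<close> assms(4) by metis
  have "q \<noteq> 0" using q by auto
  then have "multiplicity p x = multiplicity p y + multiplicity p (q ^ e)"
    unfolding e using assms(2) \<open>y \<noteq> 0\<close> by (intro prime_elem_multiplicity_mult_distrib) auto
  moreover have "multiplicity p (q ^ e) = 0"
    using assms(2,3) q by (intro multiplicity_distinct_prime_power) auto
  ultimately show ?thesis by simp
qed

text \<open>Reachability from one vertex gives connectedness and the unique highest p-planes. The
  path of 2-edges controls the components left after deleting the highest 2-edges.\<close>

lemma condI_if_strong:
  assumes s1: "strong1 M" and s2: "strong2 M" and M0: "0 \<notin> M"
  shows "condI M"
proof -
  obtain m1 where m1: "m1 \<in> M" and reach: "\<And>v. v \<in> M \<Longrightarrow> (m1, v) \<in> {(x, y). gedge M x y}\<^sup>*"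
    using s1 unfolding strong1_def by blast
  have "graph_connected M"
    unfolding graph_connected_def
    using uconn_trans[OF uconn_sym] uconn_of_rtrancl[OF reach] by blast
  moreover have "at_most_two_components_without_highest_2edges M"
  proof -
    obtain xs where xs: "xs \<noteq> []" "set xs \<subseteq> M"
      and path: "\<And>i. Suc i < length xs \<Longrightarrow> pedge M 2 (xs ! i) (xs ! Suc i)"
      and hit: "\<And>C. pplane M 2 C \<Longrightarrow> \<exists>x\<in>set xs. x \<in> C"
      using s2 unfolding strong2_def by blast
    let ?E = "\<lambda>x y. gedge M x y \<and> \<not> highest_pedge M 2 x y"
    \<comment> \<open>The second representative is the second vertex of the path; a path with a
      single vertex uses that vertex twice.\<close>
    define b where "b = xs ! (if length xs = 1 then 0 else 1)"
    have "b \<in> M" "xs ! 0 \<in> M"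
      using xs unfolding b_def by (auto simp: nth_mem subset_iff Suc_lessI)
    \<comment> \<open>Only the first edge of the path can be a highest 2-edge: at the source of
      every later edge the preceding one ends.\<close>
    have tail: "uconn ?E (xs ! Suc i) (xs ! 1)" if "Suc i < length xs" for i
      using that
    proof (induction i)
      case 0
      then show ?case by (simp add: uconn_refl)
    next
      case (Suc i)
      have e: "pedge M 2 (xs ! Suc i) (xs ! Suc (Suc i))" "pedge M 2 (xs ! i) (xs ! Suc i)"
        using path Suc.prems by auto
      then have "?E (xs ! Suc i) (xs ! Suc (Suc i))"
        unfolding gedge_def highest_pedge_def by blast
      then have "uconn ?E (xs ! Suc (Suc i)) (xs ! Suc i)"
        by (intro uconn_sym[OF uconn_edge])
      then show ?case using uconn_trans[OF _ Suc.IH] Suc.prems by simp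
    qed
    have "uconn ?E c (xs ! 0) \<or> uconn ?E c b" if "c \<in> M" for c
    proof -
      have "pplane M 2 {u\<in>M. uconn (\<lambda>x y. gedge M x y \<and> \<not> pedge M 2 x y) c u}"
        using that unfolding pplane_def by blast
      from hit[OF this] obtain x where x: "x \<in> set xs"
        "uconn (\<lambda>x y. gedge M x y \<and> \<not> pedge M 2 x y) c x" by blast
      then have cx: "uconn ?E c x"
        by (elim uconn_mono) (auto simp: highest_pedge_def)
      obtain i where i: "i < length xs" "x = xs ! i"
        using x(1) by (metis in_set_conv_nth)
      show ?thesis
      proof (cases i)
        case 0
        then show ?thesis using cx i by simp
      next
        case (Suc k)
        then have "uconn ?E x b" using tail[of k] i unfolding b_def by simp
        then show ?thesis using uconn_trans[OF cx] by blast
      qed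
    qed
    then show ?thesis
      unfolding at_most_two_components_without_highest_2edges_def Let_def
      using \<open>b \<in> M\<close> \<open>xs ! 0 \<in> M\<close> by blast
  qed
  moreover have "\<exists>!C. highest_pplane M p C" if p: "prime p" for p
  proof -
    let ?F = "\<lambda>x y. gedge M x y \<and> \<not> pedge M p x y"
    define C where "C = {u\<in>M. uconn ?F m1 u}"
    have F_mult: "multiplicity p x = multiplicity p y" if "?F x y" for x y
      using that multiplicity_pedge_other[OF _ p _ M0] unfolding gedge_def by metis
    \<comment> \<open>Edges lead to divisors, so valuations can only drop along directed paths from
      \<open>m1\<close>.\<close>
    have le: "multiplicity p v \<le> multiplicity p m1" if "v \<in> M" for v
      using reach[OF that]
    proof (induction rule: rtrancl_induct)
      case (step y z)
      then obtain q where q: "pedge M q y z" unfolding gedge_def by blast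
      then have "z dvd y" "y \<noteq> 0" using M0 unfolding pedge_def by auto
      then have "multiplicity p z \<le> multiplicity p y"
        by (simp add: dvd_imp_multiplicity_le)
      then show ?case using step.IH by linarith
    qed simp
    \<comment> \<open>The valuation on \<open>C\<close> is that of \<open>m1\<close>, so the source
      of a p-edge ending in \<open>C\<close> would exceed the maximum.\<close>
    have "\<not> pedge M p u v" if v: "v \<in> C" for u v
    proof
      assume e: "pedge M p u v"
      then obtain k where k: "u = v * p ^ k" "k \<ge> 1" "u \<in> M" "v \<in> M"
        unfolding pedge_def by blast
      have "multiplicity p m1 = multiplicity p v"
        using v F_mult unfolding C_def by (auto elim!: uconn_invariant)
      moreover have "multiplicity p u = multiplicity p v + k"
        using k p M0
        by (metis no_zero_divisors not_prime_0 prime_elem_multiplicity_mult_distrib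
            multiplicity_same_power power_not_zero prime_imp_prime_elem not_prime_unit)
      ultimately show False using le[OF \<open>u \<in> M\<close>] k(2) by linarith
    qed
    then have "highest_pplane M p C"
      unfolding highest_pplane_def pplane_def C_def using m1 by blast
    moreover have "D = C" if D: "highest_pplane M p D" for D
    proof -
      obtain v where v: "v \<in> M" "D = {u\<in>M. uconn ?F v u}"
        using D unfolding highest_pplane_def pplane_def by blast
      \<comment> \<open>Either \<open>v\<close> lies in the p-plane of \<open>m1\<close>, or a
        p-edge ends in \<open>D\<close>, which contradicts \<open>D\<close> being highest.\<close>
      from rtrancl_enters[OF reach[OF v(1)], of "pedge M p"]
      have "uconn ?F m1 v"
      proof
        assume "\<exists>u w. pedge M p u w \<and> uconn ?F w v"
        then obtain u w where uw: "pedge M p u w" "uconn ?F w v" by blast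
        then have "w \<in> D"
          using v uconn_sym unfolding pedge_def by auto
        then show ?thesis using D uw(1) unfolding highest_pplane_def by blast
      qed
      then show ?thesis
        unfolding v(2) C_def using uconn_trans[OF uconn_sym] uconn_trans by blast
    qed
    ultimately show ?thesis by blast
  qed
  ultimately show ?thesis unfolding condI_def by blast
qed

section \<open>Paths along powers of one prime and inside filters of divisors\<close>

lemma dvd_mult_prime_power_cases:
  fixes m m3 p :: nat
  assumes "m > 0" "prime p" "m dvd m3" "m3 dvd m * p ^ e"
  obtains f where "f \<le> e" "m3 = m * p ^ f"
proof -
  obtain k where k: "m3 = m * k" using assms(3) by blast
  then have "k dvd p ^ e" using assms(1,4) by simp
  then show ?thesis using that k assms(2) divides_primepow_nat by metis
qed

lemma pedge_power:
  assumes "prime p" "m > 0" "e > 0" "m \<in> M" "m * p ^ e \<in> M"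
    and "\<And>f. 0 < f \<Longrightarrow> f < e \<Longrightarrow> m * p ^ f \<notin> M"
  shows "pedge M p (m * p ^ e) m"
  unfolding pedge_def
proof (intro conjI)
  show "\<exists>e'\<ge>1. m * p ^ e = m * p ^ e'" using assms(3) by (intro exI[of _ e]) auto
  show "\<not> (\<exists>m3\<in>M - {m * p ^ e, m}. m dvd m3 \<and> m3 dvd m * p ^ e)"
  proof
    assume "\<exists>m3\<in>M - {m * p ^ e, m}. m dvd m3 \<and> m3 dvd m * p ^ e"
    then obtain m3 where m3: "m3 \<in> M" "m3 \<noteq> m * p ^ e" "m3 \<noteq> m" "m dvd m3" "m3 dvd m * p ^ e"
      by blast
    then obtain f where f: "f \<le> e" "m3 = m * p ^ f"
      using dvd_mult_prime_power_cases assms(1,2) by metis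
    have "f \<noteq> 0" "f \<noteq> e" using m3 f by auto
    then show False using assms(6)[of f] m3 f by simp
  qed
qed (use assms in auto)

text \<open>An intermediate power lying in \<open>M\<close> splits the path into two with smaller
  exponents; if there is none, the two ends are joined by a single edge.\<close>

lemma prime_power_path:
  assumes "prime p" "m > 0" "m \<in> M" "m * p ^ e \<in> M"
  shows "(m * p ^ e, m) \<in> {(x, y). pedge M p x y}\<^sup>*"
  using assms(2-)
proof (induction e arbitrary: m rule: less_induct)
  case (less e)
  show ?case
  proof (cases "\<exists>f. 0 < f \<and> f < e \<and> m * p ^ f \<in> M")
    case True
    then obtain f where f: "0 < f" "f < e" "m * p ^ f \<in> M" by blast
    have eq: "m * p ^ e = m * p ^ f * p ^ (e - f)"
      using f(2) by (simp flip: power_add add: mult.assoc)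
    have "(m * p ^ f * p ^ (e - f), m * p ^ f) \<in> {(x, y). pedge M p x y}\<^sup>*"
      using less.IH[of "e - f" "m * p ^ f"] f less.prems eq assms(1) prime_gt_0_nat by auto
    moreover have "(m * p ^ f, m) \<in> {(x, y). pedge M p x y}\<^sup>*"
      using less f by blast
    ultimately show ?thesis unfolding eq by (rule rtrancl_trans)
  next
    case False
    show ?thesis
    proof (cases "e = 0")
      case nz: False
      then have "pedge M p (m * p ^ e) m"
        using False less.prems assms(1) by (intro pedge_power) auto
      then show ?thesis by auto
    qed simp
  qed
qed

text \<open>An order filter in the divisor lattice of \<open>t\<close>, possibly empty.\<close>

definition upclosed :: "nat \<Rightarrow> nat set \<Rightarrow> bool" where
  "upclosed t U \<longleftrightarrow> (\<forall>m\<in>U. m dvd t \<and> (\<forall>m'. m dvd m' \<and> m' dvd t \<longrightarrow> m' \<in> U))"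

text \<open>Remove the prime factors of \<open>k\<close> one at a time. The intermediate numbers are
  multiples of \<open>x\<close> dividing \<open>t\<close>, hence in \<open>U\<close>, and nothing
  lies strictly between \<open>x\<close> and \<open>x * p\<close>, so each step is an edge of the
  graph of the larger set \<open>M\<close>. \<open>Q\<close> records which primes occur.\<close>

lemma upclosed_path:
  assumes U: "upclosed t U" "U \<subseteq> M" and t: "t > 0"
    and "x \<in> U" "x * k dvd t" "\<And>p. prime p \<Longrightarrow> p dvd k \<Longrightarrow> Q p"
  shows "(x * k, x) \<in> {(x, y). \<exists>p. Q p \<and> pedge M p x y}\<^sup>*"
  using assms(4-)
proof (induction k arbitrary: x rule: less_induct)
  case (less k)
  show ?case
  proof (cases "k = 1")
    case False
    then obtain p where p: "prime p" "p dvd k" using prime_factor_nat by blast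
    then obtain l where l: "k = p * l" by blast
    have "k > 0" using less.prems(2) t by (intro Nat.gr0I) auto
    then have lk: "l < k" using l p(1) prime_gt_1_nat by simp
    have xp: "x * p \<in> U"
    proof -
      have "x * p dvd x * k" unfolding l by (simp add: mult.assoc)
      then show ?thesis using U(1) less.prems(1,2) dvd_trans unfolding upclosed_def
        by (metis dvd_triv_left)
    qed
    have "x > 0" using U(1) less.prems(1) t unfolding upclosed_def by (intro Nat.gr0I) auto
    have "(x * p * l, x * p) \<in> {(x, y). \<exists>p. Q p \<and> pedge M p x y}\<^sup>*"
    proof (rule less.IH[OF lk xp])
      show "x * p * l dvd t" using less.prems(2) unfolding l by (simp add: mult.assoc)
      show "\<And>q. prime q \<Longrightarrow> q dvd l \<Longrightarrow> Q q" using less.prems(3) unfolding l by auto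
    qed
    moreover have "pedge M p (x * p ^ 1) x"
      using p(1) \<open>x > 0\<close> xp less.prems(1) U(2) by (intro pedge_power) auto
    then have "(x * p, x) \<in> {(x, y). \<exists>p. Q p \<and> pedge M p x y}"
      using less.prems(3) p by auto
    ultimately have "(x * p * l, x) \<in> {(x, y). \<exists>p. Q p \<and> pedge M p x y}\<^sup>*"
      by (rule rtrancl_into_rtrancl)
    then show ?thesis unfolding l by (simp add: mult.assoc)
  qed simp
qed

section \<open>The 2-planes, as components for \<open>odd_edge\<close>\<close>

abbreviation odd_edge :: "nat set \<Rightarrow> nat \<Rightarrow> nat \<Rightarrow> bool" where
  "odd_edge M x y \<equiv> gedge M x y \<and> \<not> pedge M 2 x y"

text \<open>Numbers with a common odd part form a divisibility chain and can be strung into one path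
  of 2-edges, so this property is \<open>strong2\<close> with the path replaced by an odd number
  that is easier to follow through an induction.\<close>

definition two_spine :: "nat set \<Rightarrow> bool" where
  "two_spine M \<longleftrightarrow> (\<exists>q. odd q \<and> (\<forall>m\<in>M. \<exists>i. q * 2 ^ i \<in> M \<and> uconn (odd_edge M) m (q * 2 ^ i)))"

lemma odd_path_uconn:
  assumes "(a, b) \<in> {(x, y). \<exists>p. p \<noteq> 2 \<and> pedge M p x y}\<^sup>*" "0 \<notin> M"
  shows "uconn (odd_edge M) a b"
proof -
  have "{(x, y). \<exists>p. p \<noteq> 2 \<and> pedge M p x y} \<subseteq> {(x, y). odd_edge M x y}"
    using pedge_prime_unique[OF _ _ assms(2)] unfolding gedge_def by blast
  from subsetD[OF rtrancl_mono[OF this] assms(1)] show ?thesis by (rule uconn_of_rtrancl)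
qed

lemma upclosed_odd_uconn:
  assumes U: "upclosed t U" "U \<subseteq> M" and t: "t > 0" and M0: "0 \<notin> M"
    and x: "x \<in> U" "x * k dvd t" and k: "odd k"
  shows "uconn (odd_edge M) x (x * k)"
proof -
  have "(x * k, x) \<in> {(x, y). \<exists>p. p \<noteq> 2 \<and> pedge M p x y}\<^sup>*"
    using upclosed_path[OF U t x, of "\<lambda>p. p \<noteq> 2"] k by auto
  then show ?thesis by (intro uconn_sym[OF odd_path_uconn] M0)
qed

lemma odd_part:
  assumes "(x::nat) > 0"
  obtains r i where "x = r * 2 ^ i" "odd r"
proof -
  obtain k where "x = 2 ^ multiplicity 2 x * k" "\<not> 2 dvd k"
    using multiplicity_decompose'[of x 2] assms by auto
  then show ?thesis using that[of k "multiplicity 2 x"] by (simp add: mult.commute)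
qed

lemma odd_dvd_power2:
  fixes r s :: nat
  assumes "r * 2 ^ i dvd s * 2 ^ j" "odd r" "odd s"
  shows "r dvd s \<and> i \<le> j"
proof
  have "coprime r (2 ^ j)" using assms(2) by simp
  then show "r dvd s" using assms(1) coprime_dvd_mult_left_iff dvd_mult_left by blast
  have "coprime (2 ^ i) s" using assms(3) by simp
  then have "(2::nat) ^ i dvd 2 ^ j"
    using assms(1) coprime_dvd_mult_right_iff dvd_mult_right by blast
  then show "i \<le> j" by (rule power_dvd_imp_le) simp
qed

text \<open>Descend from \<open>t\<close> inside the filter to \<open>m * p ^ e\<close>, then along
  powers of \<open>p\<close> to \<open>m\<close>. A nonempty filter contains \<open>t\<close>, the
  largest element.\<close>

lemma strong1_if_upclosed:
  assumes U: "upclosed t U" "U \<subseteq> M" "U \<noteq> {}" and t: "t > 0" and M: "\<And>m. m \<in> M \<Longrightarrow> m dvd t"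
    and up: "\<And>m. m \<in> M \<Longrightarrow> \<exists>p e. prime p \<and> m * p ^ e \<in> U"
  shows "strong1 M"
proof -
  obtain m where "m \<in> U" using U(3) by blast
  then have "t \<in> U" using U(1) unfolding upclosed_def by (meson dvd_refl)
  have "(t, v) \<in> {(x, y). gedge M x y}\<^sup>*" if v: "v \<in> M" for v
  proof -
    obtain p e where pe: "prime p" "v * p ^ e \<in> U" using up v by blast
    obtain k where k: "t = v * p ^ e * k" using U(1) pe(2) unfolding upclosed_def by blast
    have "(t, v * p ^ e) \<in> {(x, y). gedge M x y}\<^sup>*"
      using upclosed_path[OF U(1,2) t pe(2), of k "\<lambda>_. True"] unfolding k gedge_def by auto
    moreover have "v > 0" using M[OF v] t by (intro Nat.gr0I) auto
    then have "(v * p ^ e, v) \<in> {(x, y). pedge M p x y}\<^sup>*"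
      using pe v U(2) by (intro prime_power_path) auto
    then have "(v * p ^ e, v) \<in> {(x, y). gedge M x y}\<^sup>*"
      by (rule rtrancl_mono[THEN subsetD, rotated]) (auto simp: gedge_def)
    ultimately show ?thesis by (rule rtrancl_trans)
  qed
  moreover have "m \<le> t" if "m \<in> M" for m using M[OF that] t by (rule dvd_imp_le)
  ultimately show ?thesis unfolding strong1_def using \<open>t \<in> U\<close> U(2) by blast
qed

text \<open>The odd part \<open>q\<close> of \<open>t\<close> is the spine. Since \<open>p\<close>
  is odd, \<open>m\<close> climbs into \<open>U\<close> within its 2-plane; there its odd part is
  enlarged to \<open>q\<close> by odd factors while the power of 2 stays fixed.\<close>

lemma two_spine_if_upclosed:
  assumes U: "upclosed t U" "U \<subseteq> M" and t: "t > 0" and M: "\<And>m. m \<in> M \<Longrightarrow> m dvd t"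
    and up: "\<And>m. m \<in> M \<Longrightarrow> \<exists>p e. prime p \<and> p \<noteq> 2 \<and> m * p ^ e \<in> U"
  shows "two_spine M"
proof -
  have M0: "0 \<notin> M" using M t by force
  obtain q c where q: "t = q * 2 ^ c" "odd q" using odd_part[OF t] .
  have "\<exists>i. q * 2 ^ i \<in> M \<and> uconn (odd_edge M) m (q * 2 ^ i)" if m: "m \<in> M" for m
  proof -
    obtain p e where pe: "prime p" "p \<noteq> 2" "m * p ^ e \<in> U" using up m by blast
    let ?x = "m * p ^ e"
    have xt: "?x dvd t" using U(1) pe(3) unfolding upclosed_def by blast
    have "?x > 0" using xt t by (intro Nat.gr0I) auto
    then obtain r i where r: "?x = r * 2 ^ i" "odd r" using odd_part by blast
    have ri: "r dvd q" "i \<le> c" using odd_dvd_power2 xt q r by metis+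
    then obtain k where k: "q = r * k" by blast
    have qx: "q * 2 ^ i = ?x * k" unfolding r k by simp
    have qt: "q * 2 ^ i dvd t" unfolding q using ri(2) by (simp add: le_imp_power_dvd)
    have "odd k" using q(2) k by simp
    have "m > 0" using m M0 by (intro Nat.gr0I) auto
    then have "(?x, m) \<in> {(x, y). pedge M p x y}\<^sup>*"
      using pe m U(2) by (intro prime_power_path) auto
    then have "(?x, m) \<in> {(x, y). \<exists>p. p \<noteq> 2 \<and> pedge M p x y}\<^sup>*"
      by (rule rtrancl_mono[THEN subsetD, rotated]) (use pe(2) in auto)
    then have "uconn (odd_edge M) m ?x" by (intro uconn_sym[OF odd_path_uconn] M0)
    moreover have "uconn (odd_edge M) ?x (q * 2 ^ i)"
      using upclosed_odd_uconn[OF U t M0 pe(3)] qt \<open>odd k\<close> unfolding qx by auto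
    moreover have "q * 2 ^ i \<in> M"
      using U pe(3) qt unfolding qx upclosed_def by (meson dvd_triv_left subsetD)
    ultimately show ?thesis using uconn_trans[of "odd_edge M" m ?x] by blast
  qed
  then show ?thesis unfolding two_spine_def using q(2) by blast
qed

text \<open>The path lists the elements \<open>q * 2 ^ i\<close> of \<open>M\<close> by decreasing
  exponent; neighbours in this list have nothing of \<open>M\<close> between them and so form a
  2-edge.\<close>

lemma two_spine_strong2:
  assumes "two_spine M" "M \<noteq> {}" and t: "t > 0" and M: "\<And>m. m \<in> M \<Longrightarrow> m dvd t"
  shows "strong2 M"
proof -
  obtain q where q: "odd q"
    and spine: "\<And>m. m \<in> M \<Longrightarrow> \<exists>i. q * 2 ^ i \<in> M \<and> uconn (odd_edge M) m (q * 2 ^ i)"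
    using assms(1) unfolding two_spine_def by blast
  have "q > 0" using q by (intro Nat.gr0I) auto
  define I where "I = {i. q * 2 ^ i \<in> M}"
  have "I \<subseteq> {..t}"
  proof
    fix i assume "i \<in> I"
    then have "q * 2 ^ i \<le> t" using M t dvd_imp_le unfolding I_def by blast
    have "i < 2 ^ i" by (rule less_exp)
    also have "2 ^ i \<le> q * 2 ^ i" using \<open>q > 0\<close> by simp
    also note \<open>q * 2 ^ i \<le> t\<close>
    finally show "i \<in> {..t}" by simp
  qed
  then have fin: "finite I" using finite_subset by blast
  define ys where "ys = rev (sorted_list_of_set I)"
  have ys: "set ys = I" unfolding ys_def using fin by simp
  have dec: "sorted_wrt (>) ys" unfolding ys_def
    by (simp add: sorted_wrt_rev) 
  let ?xs = "map (\<lambda>i. q * 2 ^ i) ys"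
  have "?xs \<noteq> []" using assms(2) spine ys unfolding I_def by fastforce
  moreover have "set ?xs \<subseteq> M" using ys unfolding I_def by auto
  moreover have "pedge M 2 (?xs ! i) (?xs ! Suc i)" if "Suc i < length ?xs" for i
  proof -
    let ?a = "ys ! i" and ?b = "ys ! Suc i"
    have len: "Suc i < length ys" using that by simp
    then have ab: "?b < ?a" using dec by (simp add: sorted_wrt_iff_nth_less)
    have ain: "?a \<in> I" "?b \<in> I" using len ys nth_mem by (metis Suc_lessD)+
    have "pedge M 2 (q * 2 ^ ?b * 2 ^ (?a - ?b)) (q * 2 ^ ?b)"
    proof (rule pedge_power)
      show "q * 2 ^ ?b * 2 ^ (?a - ?b) \<in> M"
        using ain ab unfolding I_def by (simp flip: power_add add: mult.assoc)
      fix f assume f: "0 < f" "f < ?a - ?b"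
      show "q * 2 ^ ?b * 2 ^ f \<notin> M"
      proof
        assume "q * 2 ^ ?b * 2 ^ f \<in> M"
        then have "?b + f \<in> I" unfolding I_def by (simp add: power_add mult.assoc)
        then obtain l where l: "l < length ys" "ys ! l = ?b + f"
          using ys in_set_conv_nth by metis
        \<comment> \<open>The exponents decrease strictly along the list, so a value strictly
          between two neighbours has no possible position.\<close>
        have "\<not> l < i" "l \<noteq> i" "l \<noteq> Suc i" "\<not> Suc i < l"
          using dec l f len ab unfolding sorted_wrt_iff_nth_less
          by (metis Suc_lessD add.commute less_diff_conv less_asym, auto simp: less_diff_conv)
            (metis add_lessD1 less_irrefl)
        then show False by linarith
      qed
    qed (use ain ab \<open>q > 0\<close> in \<open>auto simp: I_def\<close>)
    then show ?thesis using len ab by (simp flip: power_add add: mult.assoc)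
  qed
  moreover have "\<exists>x\<in>set ?xs. x \<in> C" if C: "pplane M 2 C" for C
  proof -
    obtain v where v: "v \<in> M" "C = {u\<in>M. uconn (odd_edge M) v u}"
      using C unfolding pplane_def by blast
    obtain i where "q * 2 ^ i \<in> M" "uconn (odd_edge M) v (q * 2 ^ i)" using spine v(1) by blast
    then show ?thesis using v(2) ys unfolding I_def by auto
  qed
  ultimately show ?thesis unfolding strong2_def by blast
qed

section \<open>Layered sets satisfy both strong conditions\<close>

inductive layered :: "nat set \<Rightarrow> bool" where
  up: "t > 0 \<Longrightarrow> upclosed t M \<Longrightarrow> layered M"
| step: "t > 0 \<Longrightarrow> d dvd t \<Longrightarrow> layered M \<Longrightarrow> (\<And>m. m \<in> M \<Longrightarrow> m dvd d) \<Longrightarrow>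
    layered ({m. m dvd t \<and> \<not> m dvd d} \<union> M)"

lemma layered_bound:
  assumes "layered M"
  obtains t where "t > 0" "\<And>m. m \<in> M \<Longrightarrow> m dvd t"
  using assms
proof (induction arbitrary: thesis)
  case (up t M)
  then show ?case unfolding upclosed_def by blast
next
  case (step t d M)
  then show ?case by (metis (mono_tags, lifting) Un_iff dvd_trans mem_Collect_eq)
qed

lemma upclosed_diff: "upclosed t {m. m dvd t \<and> \<not> m dvd d}"
  unfolding upclosed_def using dvd_trans by blast

text \<open>At the least exponent where \<open>m * p ^ e\<close> stops dividing \<open>d\<close>,
  the previous power still divides \<open>d\<close>, and one more factor \<open>p\<close> gives a
  divisor of \<open>d * p\<close>. When \<open>d * p\<close> divides \<open>t\<close>, this carries
  elements of Div(d) into the layer above.\<close>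

lemma least_nondivisor_power:
  fixes m d p :: nat
  assumes "d > 0" "prime p" "m dvd d"
  obtains e where "m * p ^ e dvd d * p" "\<not> m * p ^ e dvd d"
proof -
  have "m > 0" using assms by (intro Nat.gr0I) auto
  have "d < p ^ d" using prime_gt_1_nat[OF assms(2)] by (simp add: power_gt_expt)
  also have "\<dots> \<le> m * p ^ d" using \<open>m > 0\<close> by simp
  finally have ex: "\<not> m * p ^ d dvd d" using assms(1) nat_dvd_not_less by blast
  define e where "e = (LEAST e. \<not> m * p ^ e dvd d)"
  have e: "\<not> m * p ^ e dvd d" unfolding e_def using ex by (rule LeastI)
  then have "e \<noteq> 0" using assms(3) by (intro notI) simp
  then obtain f where f: "e = Suc f" by (cases e) auto
  have "\<not> \<not> m * p ^ f dvd d"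
    by (rule not_less_Least[of f "\<lambda>e. \<not> m * p ^ e dvd d"]) (fold e_def, simp add: f)
  then have "m * p ^ f * p dvd d * p" by (intro mult_dvd_mono) auto
  then have "m * p ^ e dvd d * p" unfolding f by (simp add: mult_ac)
  then show ?thesis using e by (rule that)
qed

text \<open>Put \<open>k = t / d\<close>. Any prime divisor of \<open>k\<close> lets all elements
  climb into the top layer, which gives \<open>strong1\<close>; an odd one also gives the spine. If
  \<open>k\<close> is a power of 2, the top layer differs from Div(d) only in higher powers of 2,
  and the spine of the inner set is extended upwards.\<close>

lemma layered_strong1_two_spine:
  assumes "layered M" "M \<noteq> {}"
  shows "strong1 M \<and> two_spine M"
  using assms
proof (induction rule: layered.induct)
  case (up t M)
  \<comment> \<open>Every element is already in the filter, so the exponent is 0 and 3 is just some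
    odd prime.\<close>
  have e: "\<exists>p e. prime p \<and> p \<noteq> 2 \<and> m * p ^ e \<in> M" if "m \<in> M" for m
    using that by (intro exI[of _ 3] exI[of _ 0]) auto
  have d: "m dvd t" if "m \<in> M" for m using up(2) that unfolding upclosed_def by blast
  have "strong1 M"
    by (rule strong1_if_upclosed[OF up(2) subset_refl up(3) up(1) ]) (erule d, metis e)
  moreover have "two_spine M"
    by (rule two_spine_if_upclosed[OF up(2) subset_refl up(1) ]) (erule d, metis e)
  ultimately show ?case ..
next
  case (step t d N)
  let ?U = "{m. m dvd t \<and> \<not> m dvd d}"
  let ?M = "?U \<union> N"
  have Mt: "\<And>m. m \<in> ?M \<Longrightarrow> m dvd t" using step.hyps(2,4) dvd_trans by blast
  have M0: "0 \<notin> ?M" using Mt step.hyps(1) by force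
  have d: "d > 0" using step.hyps by (intro Nat.gr0I) auto
  have climb: "\<exists>e. m * p ^ e \<in> ?U" if m: "m \<in> ?M" and p: "prime p" "d * p dvd t" for m p
  proof (cases "m dvd d")
    case True
    then obtain e where "m * p ^ e dvd d * p" "\<not> m * p ^ e dvd d"
      using least_nondivisor_power[OF d p(1)] by blast
    then show ?thesis using p(2) dvd_trans by blast
  next
    case False
    then have "m * p ^ 0 \<in> ?U" using Mt[OF m] by simp
    then show ?thesis by (rule exI)
  qed
  obtain k where k: "t = d * k" using step.hyps(2) by blast
  show ?case
  proof (cases "k = 1")
    case True
    then have "?M = N" using k by auto
    then show ?thesis using step by auto
  next
    case False
    then obtain p where p: "prime p" "p dvd k" using prime_factor_nat by blast
    have "?U \<noteq> {}"
    proof -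
      have "\<not> t dvd d" using k False d by (auto simp: mult.commute dvd_mult_cancel1)
      then have "t \<in> ?U" by simp
      then show ?thesis by (metis empty_iff)
    qed
    have kp: "d * q dvd t" if "q dvd k" for q using that unfolding k by simp
    have "strong1 ?M"
      by (rule strong1_if_upclosed[OF upclosed_diff Un_upper1 \<open>?U \<noteq> {}\<close> step.hyps(1)])
        (erule Mt, metis climb[OF _ p(1) kp[OF p(2)]] p(1))
    moreover have "two_spine ?M"
    proof (cases "\<exists>p. prime p \<and> p \<noteq> 2 \<and> p dvd k")
      case True
      then obtain p where "prime p" "p \<noteq> 2" "p dvd k" by blast
      note q = this
      show ?thesis
        by (rule two_spine_if_upclosed[OF upclosed_diff Un_upper1 step.hyps(1)])
          (erule Mt, metis climb[OF _ q(1) kp[OF q(3)]] q(1,2))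
    next
      case only2: False
      show ?thesis
      proof (cases "N = {}")
        case True
        show ?thesis
        proof (rule two_spine_if_upclosed[OF upclosed_diff Un_upper1 step.hyps(1)])
          show "\<And>m. m \<in> ?M \<Longrightarrow> m dvd t" by (rule Mt)
          fix m assume "m \<in> ?M"
          then have "m * 3 ^ 0 \<in> ?U" using True by simp
          moreover have "prime (3::nat)" by simp
          ultimately show "\<exists>p e. prime p \<and> p \<noteq> 2 \<and> m * p ^ e \<in> ?U"
            by (metis numeral_eq_iff semiring_norm(88))
        qed
      next
        case N: False
        then obtain q where q: "odd q"
          and spine: "\<And>m. m \<in> N \<Longrightarrow> \<exists>i. q * 2 ^ i \<in> N \<and> uconn (odd_edge N) m (q * 2 ^ i)"
          using step.IH unfolding two_spine_def by blast
        have kk: "k > 0" using step.hyps(1) k by (intro Nat.gr0I) auto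
        then obtain r c where rc: "k = r * 2 ^ c" "odd r" using odd_part by blast
        have "r = 1"
        proof (rule ccontr)
          assume "r \<noteq> 1"
          then obtain p where "prime p" "p dvd r" using prime_factor_nat by blast
          then show False using only2 rc by (metis dvd_mult2)
        qed
        obtain s b where sb: "d = s * 2 ^ b" "odd s" using odd_part[OF d] .
        have t: "t = s * 2 ^ (b + c)" unfolding k rc sb using \<open>r = 1\<close> by (simp add: power_add)
        have qs: "q dvd s"
        proof -
          obtain i where "q * 2 ^ i \<in> N" using N spine by blast
          then have "q * 2 ^ i dvd s * 2 ^ b" using step.hyps(4) sb by metis
          then show ?thesis using odd_dvd_power2 q sb(2) by blast
        qed
        have "\<exists>i. q * 2 ^ i \<in> ?M \<and> uconn (odd_edge ?M) m (q * 2 ^ i)" if m: "m \<in> ?M" for m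
        proof (cases "m \<in> N")
          case True
          then obtain i where i: "q * 2 ^ i \<in> N" "uconn (odd_edge N) m (q * 2 ^ i)"
            using spine by blast
          \<comment> \<open>A number between two elements of \<open>N\<close> divides
            \<open>d\<close>, so the new layer cannot interrupt an edge of \<open>N\<close>.\<close>
          have iff: "pedge ?M p x y \<longleftrightarrow> pedge N p x y" if "x \<in> N" "y \<in> N" for p x y
          proof -
            have "\<And>m3. m3 dvd x \<Longrightarrow> m3 \<in> ?M \<longleftrightarrow> m3 \<in> N"
              using that step.hyps(4) dvd_trans by blast
            then show ?thesis unfolding pedge_def using that by blast
          qed
          have em: "odd_edge ?M x y" if "odd_edge N x y" for x y
          proof -
            have "x \<in> N" "y \<in> N" using that unfolding gedge_def pedge_def by auto
            then show ?thesis using that iff unfolding gedge_def by blast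
          qed
          have "uconn (odd_edge ?M) m (q * 2 ^ i)" by (rule uconn_mono[OF i(2) em])
          then show ?thesis using i(1) by blast
        next
          case False
          then have mU: "m \<in> ?U" using m by blast
          then have "m > 0" using M0 by (intro Nat.gr0I) auto
          then obtain x l where xl: "m = x * 2 ^ l" "odd x" using odd_part by blast
          have xs: "x dvd s" "l \<le> b + c"
            using odd_dvd_power2[of x l s "b + c"] mU xl(2) sb(2) unfolding xl(1) t by blast+
          \<comment> \<open>The odd part of \<open>m\<close> divides that of \<open>d\<close>, so
            \<open>m\<close> can fail to divide \<open>d\<close> only through its power of
            2.\<close>
          have "b < l"
          proof (rule ccontr)
            assume "\<not> b < l"
            then have "x * 2 ^ l dvd s * 2 ^ b" using xs(1)
              by (intro mult_dvd_mono le_imp_power_dvd) auto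
            then have "m dvd d" unfolding xl sb .
            then show False using mU by blast
          qed
          have lt: "s * 2 ^ l dvd t" unfolding t using xs(2) by (intro mult_dvd_mono le_imp_power_dvd) auto
          have qU: "q * 2 ^ l \<in> ?U"
          proof -
            have "q * 2 ^ l dvd t" unfolding t using xs(2) qs by (intro mult_dvd_mono le_imp_power_dvd) auto
            moreover have "\<not> q * 2 ^ l dvd d"
              using odd_dvd_power2[of q l s b] q sb(2) \<open>b < l\<close> unfolding sb(1) by auto
            ultimately show ?thesis by blast
          qed
          \<comment> \<open>Both \<open>m\<close> and \<open>q * 2 ^ l\<close> are joined to the
            common point \<open>s * 2 ^ l\<close>: the cofactors are odd, and the filter contains
            the intermediate multiples.\<close>
          have to_s: "uconn (odd_edge ?M) (y * 2 ^ l) (s * 2 ^ l)" if yU: "y * 2 ^ l \<in> ?U" and y: "y dvd s" for y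
          proof -
            obtain z where z: "s = y * z" using y by blast
            then have "odd z" using sb(2) by simp
            then show ?thesis
              using upclosed_odd_uconn[OF upclosed_diff, of t d ?M "y * 2 ^ l" z] yU lt
                step.hyps(1) M0 unfolding z by (simp add: mult_ac)
          qed
          have "uconn (odd_edge ?M) m (q * 2 ^ l)"
            using uconn_trans[OF to_s[of x] uconn_sym[OF to_s[of q]]] mU qU xs(1) qs unfolding xl(1) by blast
          then show ?thesis using qU by blast
        qed
        then show ?thesis unfolding two_spine_def using q by blast
      qed
    qed
    ultimately show ?thesis by blast
  qed
qed

lemma layered_conditions:
  assumes "layered M" "M \<noteq> {}"
  shows "condI M \<and> strong1 M \<and> strong2 M"
proof -
  obtain t where t: "t > 0" "\<And>m. m \<in> M \<Longrightarrow> m dvd t" using layered_bound[OF assms(1)] by blast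
  have "0 \<notin> M" using t by force
  then show ?thesis
    using layered_strong1_two_spine[OF assms] two_spine_strong2 condI_if_strong assms(2) t by metis
qed

section \<open>Expansion of the divisor\<close>

lemma Lambda_eq: "d > 0 \<Longrightarrow> Lambda d z = (if z ^ d = 1 then 1 else 0)"
proof -
  assume d: "d > 0"
  have "{cis (2 * pi * real a / real d) | a. a < d} = {z. z ^ d = 1}"
    using bij_betw_roots_unity[OF d] unfolding bij_betw_def by auto
  then show ?thesis unfolding Lambda_def by simp
qed

lemma power_gcd_eq_1:
  fixes h :: complex
  assumes "h ^ a = 1" "h ^ b = 1" "a > 0"
  shows "h ^ gcd a b = 1"
proof -
  obtain u v where uv: "a * u = b * v + gcd a b" using bezout_nat[of a b] assms(3) by auto
  have "h ^ (a * u) = h ^ (b * v) * h ^ gcd a b" unfolding uv by (simp add: power_add)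
  then show ?thesis using assms by (simp add: power_mult)
qed

lemma power_eq_1_dvd:
  fixes h :: complex
  assumes "h ^ a = 1" "a dvd b"
  shows "h ^ b = 1"
  using assms by (auto simp: power_mult elim!: dvdE)

text \<open>Multiplication maps the pairs of an a-th and a b-th root of unity onto the lcm-th roots;
  its kernel consists of the pairs (h, 1/h) with h a gcd-th root, so all nonempty fibres have gcd(a,
  b) elements.\<close>

lemma card_factorisations:
  fixes z :: complex
  assumes a: "a > 0" and b: "b > 0"
  shows "card {(x, y). x ^ a = 1 \<and> y ^ b = 1 \<and> x * y = z} = (if z ^ lcm a b = 1 then gcd a b else 0)"
proof (cases "z ^ lcm a b = 1")
  case False
  have e: "{(x, y). x ^ a = 1 \<and> y ^ b = 1 \<and> x * y = z} = {}"
    using False power_eq_1_dvd[of _ _ "lcm a b"] by (auto simp: power_mult_distrib)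
  show ?thesis unfolding e using False by simp
next
  case True
  let ?S = "{(x, y). x ^ a = 1 \<and> y ^ b = 1 \<and> x * y = z}"
  let ?g = "gcd a b"
  have g: "?g > 0" using a by simp
  have l: "lcm a b > 0" using a b by (simp add: lcm_pos_nat)
  have z0: "z \<noteq> 0" using True l by (auto simp: power_0_left split: if_splits)
  obtain u v where uv: "a * u = b * v + ?g" using bezout_nat[of a b] a by auto
  obtain a' b' where ab: "a = ?g * a'" "b = ?g * b'" by (meson dvdE gcd_dvd1 gcd_dvd2)
  have "?g * (a * b') = a * (?g * b')" "?g * (b * a') = b * (?g * a')" by (simp_all only: mult_ac)
  then have "?g * (a * b') = ?g * lcm a b" "?g * (b * a') = ?g * lcm a b"
    unfolding ab[symmetric] by (simp_all add: mult.commute flip: prod_gcd_lcm_nat)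
  then have lab: "a * b' = lcm a b" "b * a' = lcm a b" using g by (metis mult_cancel1 nat_neq_iff)+
  have "?g * (a' * u) = ?g * (b' * v + 1)" using uv ab by (metis distrib_left mult.assoc mult.right_neutral)
  then have uv': "a' * u = b' * v + 1" using g by (metis mult_cancel1 nat_neq_iff)
  \<comment> \<open>Bezout in the form a' u - b' v = 1 splits \<open>z\<close> into a power with
    exponent -b' v and one with exponent a' u; since a b' = b a' = lcm, this is a point of the
    fibre.\<close>
  define x0 where "x0 = inverse z ^ (b' * v)"
  define y0 where "y0 = z ^ (a' * u)"
  have x0: "x0 ^ a = 1"
  proof -
    have "x0 ^ a = inverse ((z ^ lcm a b) ^ v)"
      unfolding x0_def lab(1)[symmetric] power_inverse power_mult[symmetric] by (simp add: mult_ac)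
    then show ?thesis using True by simp
  qed
  have y0: "y0 ^ b = 1"
  proof -
    have "y0 ^ b = (z ^ lcm a b) ^ u"
      unfolding y0_def lab(2)[symmetric] power_mult[symmetric] by (simp add: mult_ac)
    then show ?thesis using True by simp
  qed
  have xy0: "x0 * y0 = z"
    unfolding x0_def y0_def uv' using z0 by (simp add: power_inverse power_add)
  have n0: "x0 \<noteq> 0" "y0 \<noteq> 0" using xy0 z0 by auto
  have "bij_betw (\<lambda>h. (x0 * h, y0 / h)) {h. h ^ ?g = 1} ?S"
  proof (rule bij_betw_byWitness[where f' = "\<lambda>(x, y). x / x0"])
    show "\<forall>h\<in>{h. h ^ ?g = 1}. (case (x0 * h, y0 / h) of (x, y) \<Rightarrow> x / x0) = h"
      using n0 by simp
    show "\<forall>p\<in>?S. (x0 * (case p of (x, y) \<Rightarrow> x / x0), y0 / (case p of (x, y) \<Rightarrow> x / x0)) = p"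
    proof -
      have "y0 / (x / x0) = y" if xy: "x * y = z" for x y
      proof -
        have "x \<noteq> 0" using z0 xy by auto
        then show ?thesis using n0 xy0 xy by (simp add: field_simps)
      qed
      then show ?thesis using n0 by auto
    qed
    show "(\<lambda>h. (x0 * h, y0 / h)) ` {h. h ^ ?g = 1} \<subseteq> ?S"
    proof (rule image_subsetI)
      fix h :: complex assume "h \<in> {h. h ^ ?g = 1}"
      then have h: "h ^ ?g = 1" by simp
      have "h \<noteq> 0" using h g by (auto simp: power_0_left split: if_splits)
      moreover have "h ^ a = 1" "h ^ b = 1" using power_eq_1_dvd[OF h] by auto
      ultimately show "(x0 * h, y0 / h) \<in> ?S"
        using x0 y0 xy0 by (simp add: power_mult_distrib power_divide)
    qed
    show "(\<lambda>(x, y). x / x0) ` ?S \<subseteq> {h. h ^ ?g = 1}"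
    proof (rule image_subsetI)
      fix p assume "p \<in> ?S"
      then obtain x y where p: "p = (x, y)" and xy: "x ^ a = 1" "y ^ b = 1" "z = x * y" by auto
      have "y \<noteq> 0" using xy z0 by auto
      have "x / x0 = y0 / y" using xy xy0 n0 \<open>y \<noteq> 0\<close> by (simp add: field_simps)
      moreover have "(x / x0) ^ a = 1" "(y0 / y) ^ b = 1"
        using xy x0 y0 by (simp_all add: power_divide)
      ultimately show "(case p of (x, y) \<Rightarrow> x / x0) \<in> {h. h ^ ?g = 1}"
        using power_gcd_eq_1 a unfolding p by simp
    qed
  qed
  then have "card ?S = card {h::complex. h ^ ?g = 1}" by (rule bij_betw_same_card[symmetric])
  then show ?thesis using True card_roots_unity_eq[OF g] by simp
qed

text \<open>Replaces the index set depending on \<open>z\<close> by a fixed finite product, so that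
  sums can be exchanged.\<close>

lemma gr_mult_sum:
  assumes "finite X" "finite Y" "\<And>x. f x \<noteq> 0 \<Longrightarrow> x \<in> X" "\<And>y. g y \<noteq> 0 \<Longrightarrow> y \<in> Y"
  shows "gr_mult f g z = (\<Sum>x\<in>X. \<Sum>y\<in>Y. if x * y = z then f x * g y else 0)"
proof -
  have "gr_mult f g z = (\<Sum>(x,y)\<in>{(x,y). f x \<noteq> 0 \<and> g y \<noteq> 0 \<and> x * y = z}. if x * y = z then f x * g y else 0)"
    unfolding gr_mult_def by (rule sum.cong) auto
  also have "\<dots> = (\<Sum>(x,y)\<in>X \<times> Y. if x * y = z then f x * g y else 0)"
    by (rule sum.mono_neutral_left) (use assms in \<open>auto split: if_splits\<close>)
  finally show ?thesis by (simp add: sum.cartesian_product)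
qed

text \<open>The product rule for Lambda_a and Lambda_b; the coefficient counts factorisations.
  Summation over the roots of a common order \<open>N\<close> keeps the index set independent of
  \<open>a\<close> and \<open>b\<close>.\<close>

lemma Lambda_convolution:
  assumes "a > 0" "b > 0" "N > 0" "a dvd N" "b dvd N"
  shows "(\<Sum>x\<in>{x. x ^ N = 1}. \<Sum>y\<in>{y. y ^ N = 1}. if x * y = z then Lambda a x * Lambda b y else 0)
    = of_nat (gcd a b) * Lambda (lcm a b) z"
proof -
  let ?R = "{x::complex. x ^ N = 1}"
  let ?S = "{(x, y). x ^ a = 1 \<and> y ^ b = 1 \<and> x * y = z}"
  have fin: "finite ?R" using assms(3) by (intro finite_roots_unity) simp
  have "(\<Sum>x\<in>?R. \<Sum>y\<in>?R. if x * y = z then Lambda a x * Lambda b y else 0)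
      = (\<Sum>p\<in>?R \<times> ?R. if p \<in> ?S then 1 else 0)"
    unfolding sum.cartesian_product by (rule sum.cong) (auto simp: Lambda_eq assms split: if_splits)
  also have "\<dots> = of_nat (card ((?R \<times> ?R) \<inter> ?S))"
    using fin by (simp add: sum.If_cases)
  also have "(?R \<times> ?R) \<inter> ?S = ?S"
    using power_eq_1_dvd assms(4,5) by auto
  also have "of_nat (card ?S) = of_nat (gcd a b) * Lambda (lcm a b) z"
    using assms by (simp add: card_factorisations Lambda_eq lcm_pos_nat)
  finally show ?thesis .
qed

lemma Lambda_sum_support:
  assumes "(\<Sum>i\<in>K. b i * Lambda (d i) x) \<noteq> 0"
    and "\<And>i. i \<in> K \<Longrightarrow> d i dvd N" "\<And>i. i \<in> K \<Longrightarrow> d i > 0"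
  shows "x ^ N = 1"
proof -
  obtain i where i: "i \<in> K" "Lambda (d i) x \<noteq> 0"
    using assms(1) by (metis (mono_tags, lifting) mult_zero_right sum.neutral)
  then have "x ^ d i = 1" using assms(3)[OF i(1)] by (auto simp: Lambda_eq split: if_splits)
  then show ?thesis using power_eq_1_dvd assms(2)[OF i(1)] by blast
qed

lemma gr_mult_Lambda:
  assumes "finite I" "finite J" "\<And>i. i \<in> I \<Longrightarrow> d i > 0" "\<And>j. j \<in> J \<Longrightarrow> e j > 0"
  shows "gr_mult (\<lambda>z. \<Sum>i\<in>I. b i * Lambda (d i) z) (\<lambda>z. \<Sum>j\<in>J. c j * Lambda (e j) z) z
    = (\<Sum>i\<in>I. \<Sum>j\<in>J. b i * c j * of_nat (gcd (d i) (e j)) * Lambda (lcm (d i) (e j)) z)"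
proof -
  \<comment> \<open>A common multiple of all orders involved: its roots of unity contain both
    supports.\<close>
  define N where "N = (\<Prod>i\<in>I. d i) * (\<Prod>j\<in>J. e j)"
  have N: "N > 0" unfolding N_def using assms by (simp add: prod_pos)
  have dN: "d i dvd N" if "i \<in> I" for i
    unfolding N_def using that assms(1) by (simp add: dvd_prodI dvd_mult2)
  have eN: "e j dvd N" if "j \<in> J" for j
    unfolding N_def using that assms(2) by (simp add: dvd_prodI dvd_mult)
  let ?R = "{x::complex. x ^ N = 1}"
  have fin: "finite ?R" using N by (intro finite_roots_unity) simp
  have "gr_mult (\<lambda>z. \<Sum>i\<in>I. b i * Lambda (d i) z) (\<lambda>z. \<Sum>j\<in>J. c j * Lambda (e j) z) z
     = (\<Sum>x\<in>?R. \<Sum>y\<in>?R. if x * y = z then (\<Sum>i\<in>I. b i * Lambda (d i) x) * (\<Sum>j\<in>J. c j * Lambda (e j) y) else 0)"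
    by (rule gr_mult_sum[OF fin fin])
      (use Lambda_sum_support[OF _ dN assms(3)] Lambda_sum_support[OF _ eN assms(4)] in simp_all)
  also have "\<dots> = (\<Sum>x\<in>?R. \<Sum>y\<in>?R. \<Sum>i\<in>I. \<Sum>j\<in>J.
      b i * c j * (if x * y = z then Lambda (d i) x * Lambda (e j) y else 0))"
    by (intro sum.cong refl) (auto simp: sum_product mult_ac)
  also have "\<dots> = (\<Sum>x\<in>?R. \<Sum>i\<in>I. \<Sum>y\<in>?R. \<Sum>j\<in>J.
      b i * c j * (if x * y = z then Lambda (d i) x * Lambda (e j) y else 0))"
    by (rule sum.cong[OF refl], rule sum.swap)
  also have "\<dots> = (\<Sum>i\<in>I. \<Sum>x\<in>?R. \<Sum>j\<in>J. \<Sum>y\<in>?R.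
      b i * c j * (if x * y = z then Lambda (d i) x * Lambda (e j) y else 0))"
    by (subst sum.swap, intro sum.cong refl, rule sum.swap)
  also have "\<dots> = (\<Sum>i\<in>I. \<Sum>j\<in>J. \<Sum>x\<in>?R. \<Sum>y\<in>?R.
      b i * c j * (if x * y = z then Lambda (d i) x * Lambda (e j) y else 0))"
    by (intro sum.cong refl, rule sum.swap)
  also have "\<dots> = (\<Sum>i\<in>I. \<Sum>j\<in>J. b i * c j * (of_nat (gcd (d i) (e j)) * Lambda (lcm (d i) (e j)) z))"
    unfolding sum_distrib_left[symmetric]
    by (intro sum.cong refl) (use assms N dN eN Lambda_convolution in auto)
  finally show ?thesis by (simp add: mult.assoc)
qed

section \<open>Denominators, and the expansion of D_w over subsets of the variables\<close>

definition den :: "rat \<Rightarrow> nat" where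
  "den q = nat (wden q)"

lemma den_pos: "den q > 0"
  unfolding den_def wden_def using quotient_of_denom_pos' by simp

text \<open>Eliminates numerators: 1 / s_j becomes 1 / (t_j w_j), leaving only denominators and
  weights in the coefficients.\<close>

lemma wnum_eq: "of_int (wnum q) = of_nat (den q) * q"
proof -
  obtain a b where ab: "quotient_of q = (a, b)" by force
  have "q = of_int a / of_int b" using quotient_of_div[OF ab] .
  moreover have "b > 0" using quotient_of_denom_pos[OF ab] .
  ultimately show ?thesis unfolding wnum_def wden_def den_def ab by simp
qed

text \<open>Numerator and denominator are coprime. All later divisibilities between denominators are
  read off from this criterion.\<close>

lemma den_dvd_iff: "den q dvd k \<longleftrightarrow> of_nat k * q \<in> \<int>"
proof
  assume "den q dvd k"
  then obtain l where "k = den q * l" by blast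
  then have "of_nat k * q = of_int (wnum q * int l)"
    unfolding of_int_mult wnum_eq by simp
  then show "of_nat k * q \<in> \<int>" by (metis Ints_of_int)
next
  assume "of_nat k * q \<in> \<int>"
  then obtain i where i: "of_nat k * q = of_int i" by (auto elim: Ints_cases)
  have "of_int (int k * wnum q) = (of_int (i * int (den q)) :: rat)"
    unfolding of_int_mult wnum_eq using i by (simp add: mult_ac)
  then have "int k * wnum q = i * int (den q)" by (simp only: of_int_eq_iff)
  then have "int (den q) dvd int k * wnum q" by simp
  moreover have "coprime (wnum q) (int (den q))"
  proof -
    obtain a b where ab: "quotient_of q = (a, b)" by force
    then show ?thesis
      using quotient_of_coprime[OF ab] quotient_of_denom_pos[OF ab]
      unfolding wnum_def wden_def den_def by simp
  qed
  ultimately have "int (den q) dvd int k"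
    by (simp add: coprime_dvd_mult_left_iff coprime_commute)
  then show "den q dvd k" by simp
qed

definition den_Lcm :: "(nat \<Rightarrow> rat) \<Rightarrow> nat set \<Rightarrow> nat" where
  "den_Lcm w A = Lcm ((\<lambda>j. den (w j)) ` A)"

lemma den_Lcm_empty [simp]: "den_Lcm w {} = 1"
  and den_Lcm_insert [simp]: "den_Lcm w (insert j A) = lcm (den (w j)) (den_Lcm w A)"
  unfolding den_Lcm_def by simp_all

lemma den_Lcm_pos: "finite A \<Longrightarrow> den_Lcm w A > 0"
  by (induction A rule: finite_induct) (auto simp: lcm_pos_nat den_pos)

text \<open>The product of the Lambda_t over \<open>A\<close> is (product of the t_j / lcm) times
  Lambda_lcm; dividing by the numerators t_j w_j leaves the lcm and the weights. The sign from the
  factors -Lambda_1 outside \<open>A\<close> is written as (-1)^n (-1)^|A|, and (-1)^n is kept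
  outside to make the coefficient independent of \<open>n\<close>.\<close>

definition Lambda_coeff :: "(nat \<Rightarrow> rat) \<Rightarrow> nat set \<Rightarrow> rat" where
  "Lambda_coeff w A = (-1) ^ card A / (of_nat (den_Lcm w A) * (\<Prod>j\<in>A. w j))"

lemma sum_Pow_insert:
  assumes "finite A" "x \<notin> A"
  shows "(\<Sum>X\<in>Pow (insert x A). f X) = (\<Sum>X\<in>Pow A. f X) + (\<Sum>X\<in>Pow A. f (insert x X))"
proof -
  have "(\<Sum>X\<in>Pow (insert x A). f X) = (\<Sum>X\<in>Pow A. f X) + (\<Sum>X\<in>insert x ` Pow A. f X)"
    unfolding Pow_insert by (rule sum.union_disjoint) (use assms in auto)
  also have "(\<Sum>X\<in>insert x ` Pow A. f X) = (\<Sum>X\<in>Pow A. f (insert x X))"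
    using assms(2) by (subst sum.reindex) (auto simp: inj_on_def)
  finally show ?thesis .
qed

text \<open>A new factor contributes either its term Lambda_t / s, which puts the new index into
  \<open>A\<close>, or -Lambda_1, which leaves \<open>A\<close> alone; the two choices are indexed
  by a boolean.\<close>

lemma Dprod_eq:
  assumes "\<And>j. j \<in> {1..n} \<Longrightarrow> w j \<noteq> 0"
  shows "Dprod w n = (\<lambda>z. \<Sum>A\<in>Pow {1..n}. ((-1) ^ n * Lambda_coeff w A) * Lambda (den_Lcm w A) z)"
  using assms
proof (induction n)
  case 0
  then show ?case by (simp add: gr_one_def fun_eq_iff Lambda_eq Lambda_coeff_def)
next
  case (Suc n)
  let ?t = "den (w (Suc n))"
  let ?c = "\<lambda>b. if b then 1 / of_int (wnum (w (Suc n))) else - 1 :: rat"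
  let ?e = "\<lambda>b. if b then ?t else 1"
  have f: "Dfactor w (Suc n) = (\<lambda>z. \<Sum>b\<in>UNIV. ?c b * Lambda (?e b) z)"
    unfolding Dfactor_def den_def by (simp add: UNIV_bool fun_eq_iff)
  have pos: "den_Lcm w A > 0" if "A \<in> Pow {1..n}" for A
    using that den_Lcm_pos finite_subset by blast
  have IH: "Dprod w n = (\<lambda>z. \<Sum>A\<in>Pow {1..n}. ((-1) ^ n * Lambda_coeff w A) * Lambda (den_Lcm w A) z)"
    using Suc by simp
  show ?case
  proof (rule ext)
    fix z
    \<comment> \<open>The gcd from the product rule turns the product of the new denominator and the
      old lcm into the new lcm.\<close>
    have new: "Lambda_coeff w (insert (Suc n) A)
        = - (Lambda_coeff w A / of_int (wnum (w (Suc n))) * of_nat (gcd (den_Lcm w A) ?t))"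
      if A: "A \<subseteq> {1..n}" for A
    proof -
      have fin: "finite A" "Suc n \<notin> A" using A finite_subset by auto
      have "of_nat (lcm ?t (den_Lcm w A)) * of_nat (gcd (den_Lcm w A) ?t) = (of_nat ?t * of_nat (den_Lcm w A) :: rat)"
        unfolding of_nat_mult[symmetric] prod_gcd_lcm_nat[of ?t "den_Lcm w A"]
        by (simp only: gcd.commute mult.commute)
      moreover have "(of_nat (gcd (den_Lcm w A) ?t) :: rat) \<noteq> 0" using den_pos[of "w (Suc n)"] by simp
      ultimately have e: "(of_nat (lcm ?t (den_Lcm w A)) :: rat)
          = of_nat ?t * of_nat (den_Lcm w A) / of_nat (gcd (den_Lcm w A) ?t)"
        by (intro iffD2[OF nonzero_eq_divide_eq])
      show ?thesis
        unfolding Lambda_coeff_def wnum_eq den_Lcm_insert e using fin by (simp add: field_simps)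
    qed
    have "Dprod w (Suc n) z = (\<Sum>A\<in>Pow {1..n}. \<Sum>b\<in>UNIV. ((-1) ^ n * Lambda_coeff w A) * ?c b *
        of_nat (gcd (den_Lcm w A) (?e b)) * Lambda (lcm (den_Lcm w A) (?e b)) z)"
      unfolding Dprod.simps IH f
      by (rule gr_mult_Lambda) (use pos den_pos in auto)
    also have "\<dots> = (\<Sum>A\<in>Pow {1..n}. ((-1) ^ Suc n * Lambda_coeff w A) * Lambda (den_Lcm w A) z
        + ((-1) ^ Suc n * Lambda_coeff w (insert (Suc n) A)) * Lambda (den_Lcm w (insert (Suc n) A)) z)"
      by (rule sum.cong[OF refl]) (simp add: UNIV_bool new lcm.commute)
    also have "\<dots> = (\<Sum>A\<in>Pow (insert (Suc n) {1..n}). ((-1) ^ Suc n * Lambda_coeff w A) * Lambda (den_Lcm w A) z)"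
      by (subst sum_Pow_insert) (auto simp: sum.distrib sum_negf sum_subtractf)
    also have "insert (Suc n) {1..n} = {1..Suc n}" by auto
    finally show "Dprod w (Suc n) z = (\<Sum>A\<in>Pow {1..Suc n}. ((-1) ^ Suc n * Lambda_coeff w A) * Lambda (den_Lcm w A) z)" .
  qed
qed

section \<open>The multiplicities nu(m)\<close>

lemma cis_root_power_eq_1_iff:
  assumes "m \<ge> 1"
  shows "cis (2 * pi / real m) ^ d = 1 \<longleftrightarrow> m dvd d"
proof -
  have "cis (2 * pi / real m) ^ d = cis (2 * pi * real d / real m)" by (simp add: DeMoivre mult_ac)
  moreover have "cis (2 * pi * real d / real m) = 1 \<longleftrightarrow> m dvd d"
  proof
    assume "cis (2 * pi * real d / real m) = 1"
    then have "cos (2 * pi * real d / real m) = 1" by (simp add: complex_eq_iff)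
    then obtain i :: int where "2 * pi * real d / real m = real_of_int i * 2 * pi"
      by (subst (asm) cos_one_2pi_int) blast
    then have "real_of_int (int d) = real_of_int (i * int m)"
      using assms by (simp add: field_simps)
    then have "int d = i * int m" by (simp only: of_int_eq_iff)
    then have "int m dvd int d" by simp
    then show "m dvd d" by simp
  next
    assume "m dvd d"
    then obtain k where k: "d = m * k" by blast
    have "cis (2 * pi * real d / real m) = cis (2 * pi) ^ k"
      unfolding DeMoivre k using assms by (simp add: mult_ac)
    then show "cis (2 * pi * real d / real m) = 1" by simp
  qed
  ultimately show ?thesis by simp
qed

text \<open>For positive \<open>d\<close>, the value of Lambda_d at a root of unity of order
  \<open>m\<close>.\<close>

definition ind :: "nat \<Rightarrow> nat \<Rightarrow> rat" where
  "ind d m = (if m dvd d then 1 else 0)"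

lemma nu_eq:
  assumes "\<And>j. j \<in> {1..n} \<Longrightarrow> w j \<noteq> 0" "m \<ge> 1"
  shows "nu n w m = (-1) ^ n * (\<Sum>A\<in>Pow {1..n}. Lambda_coeff w A * ind (den_Lcm w A) m)"
proof -
  have L: "Lambda (den_Lcm w A) (cis (2 * pi / real m)) = ind (den_Lcm w A) m" if "A \<in> Pow {1..n}" for A
    using that den_Lcm_pos[of A w] finite_subset[of A "{1..n}"]
    by (simp add: Lambda_eq cis_root_power_eq_1_iff[OF assms(2)] ind_def)
  have "Dprod w n = (\<lambda>z. \<Sum>A\<in>Pow {1..n}. ((-1) ^ n * Lambda_coeff w A) * Lambda (den_Lcm w A) z)"
    by (rule Dprod_eq) (rule assms(1))
  then have "nu n w m = (\<Sum>A\<in>Pow {1..n}. ((-1) ^ n * Lambda_coeff w A) *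
      Lambda (den_Lcm w A) (cis (2 * pi / real m)))"
    by (simp only: nu_def)
  also have "\<dots> = (\<Sum>A\<in>Pow {1..n}. (-1) ^ n * (Lambda_coeff w A * ind (den_Lcm w A) m))"
    by (rule sum.cong[OF refl]) (simp only: L mult.assoc)
  finally show ?thesis unfolding sum_distrib_left .
qed

lemma nu_permute:
  assumes w: "\<And>j. j \<in> {1..n} \<Longrightarrow> w j \<noteq> 0" and s: "bij_betw \<sigma> {1..n} {1..n}" and m: "m \<ge> 1"
  shows "nu n (w \<circ> \<sigma>) m = nu n w m"
proof -
  have w': "(w \<circ> \<sigma>) j \<noteq> 0" if "j \<in> {1..n}" for j
  proof -
    have "\<sigma> j \<in> {1..n}" using bij_betwE[OF s] that by blast
    then show ?thesis using w by simp
  qed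
  have "(\<Sum>A\<in>Pow {1..n}. Lambda_coeff w A * ind (den_Lcm w A) m)
      = (\<Sum>A\<in>Pow {1..n}. Lambda_coeff w (\<sigma> ` A) * ind (den_Lcm w (\<sigma> ` A)) m)"
    by (rule sum.reindex_bij_betw[symmetric, OF bij_betw_Pow[OF s]])
  also have "\<dots> = (\<Sum>A\<in>Pow {1..n}. Lambda_coeff (w \<circ> \<sigma>) A * ind (den_Lcm (w \<circ> \<sigma>) A) m)"
  proof (rule sum.cong[OF refl])
    fix A assume A: "A \<in> Pow {1..n}"
    then have inj: "inj_on \<sigma> A" using s inj_on_subset unfolding bij_betw_def by blast
    have "den_Lcm w (\<sigma> ` A) = den_Lcm (w \<circ> \<sigma>) A"
      unfolding den_Lcm_def by (simp add: image_image)
    then show "Lambda_coeff w (\<sigma> ` A) * ind (den_Lcm w (\<sigma> ` A)) m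
        = Lambda_coeff (w \<circ> \<sigma>) A * ind (den_Lcm (w \<circ> \<sigma>) A) m"
      unfolding Lambda_coeff_def by (simp add: card_image[OF inj] prod.reindex[OF inj])
  qed
  finally have "(\<Sum>A\<in>Pow {1..n}. Lambda_coeff w A * ind (den_Lcm w A) m)
      = (\<Sum>A\<in>Pow {1..n}. Lambda_coeff (w \<circ> \<sigma>) A * ind (den_Lcm (w \<circ> \<sigma>) A) m)" .
  moreover have "nu n w m = (-1) ^ n * (\<Sum>A\<in>Pow {1..n}. Lambda_coeff w A * ind (den_Lcm w A) m)"
    by (rule nu_eq[OF w m])
  moreover have "nu n (w \<circ> \<sigma>) m
      = (-1) ^ n * (\<Sum>A\<in>Pow {1..n}. Lambda_coeff (w \<circ> \<sigma>) A * ind (den_Lcm (w \<circ> \<sigma>) A) m)"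
    by (rule nu_eq[OF w' m])
  ultimately show ?thesis by (simp only:)
qed

text \<open>By \<open>nu_eq\<close> the value depends only on the set \<open>P\<close> of those
  subsets whose lcm is a multiple of \<open>m\<close>, and there are finitely many such
  \<open>P\<close>. Hence \<open>nu_max\<close> is attained.\<close>

lemma finite_nu_values:
  assumes "\<And>j. j \<in> {1..n} \<Longrightarrow> w j \<noteq> 0"
  shows "finite {nu n w m | m. m \<ge> 1}"
proof -
  let ?g = "\<lambda>P. (-1) ^ n * (\<Sum>A\<in>Pow {1..n}. Lambda_coeff w A * (if A \<in> P then 1 else 0))"
  have "{nu n w m | m. m \<ge> 1} \<subseteq> ?g ` Pow (Pow {1..n})"
  proof
    fix v assume "v \<in> {nu n w m | m. m \<ge> 1}"
    then obtain m where m: "m \<ge> 1" "v = nu n w m" by blast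
    have "(\<Sum>A\<in>Pow {1..n}. Lambda_coeff w A * ind (den_Lcm w A) m)
        = (\<Sum>A\<in>Pow {1..n}. Lambda_coeff w A * (if A \<in> {A \<in> Pow {1..n}. m dvd den_Lcm w A} then 1 else 0))"
      by (rule sum.cong[OF refl]) (simp add: ind_def)
    then have "v = ?g {A \<in> Pow {1..n}. m dvd den_Lcm w A}"
      using nu_eq[of n w m] assms m by simp
    then show "v \<in> ?g ` Pow (Pow {1..n})" by blast
  qed
  then show ?thesis by (rule finite_subset) simp
qed

section \<open>Superlevel sets\<close>

lemma upclosedI:
  assumes "\<And>m. m \<in> U \<Longrightarrow> m dvd t" "\<And>m m'. m \<in> U \<Longrightarrow> m dvd m' \<Longrightarrow> m' dvd t \<Longrightarrow> m' \<in> U"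
  shows "upclosed t U"
  using assms unfolding upclosed_def by blast

lemma layered_empty: "layered {}"
  by (rule layered.up[of 1]) (simp_all add: upclosed_def)

lemma layered_divisors: "t > 0 \<Longrightarrow> layered {m. m dvd t}"
  by (rule layered.up[of t]) (auto intro: upclosedI)

lemma layered_proper_divisors:
  assumes "t > 0" "d dvd t"
  shows "layered {m. m dvd t \<and> \<not> m dvd d}"
  using layered.step[OF assms layered_empty] by simp

lemma nu_0: "m \<ge> 1 \<Longrightarrow> nu 0 v m = ind 1 m"
  using nu_eq[of 0 v m] by (simp add: Lambda_coeff_def)

text \<open>The product over j is the degree of the divisor of the first k factors: multiplying by
  \<open>\<Lambda>\<^sub>t\<close> only sees the degree when all denominators divide \<open>t\<close>.\<close>

lemma nu_Suc:
  assumes v: "\<And>j. j \<in> {1..Suc k} \<Longrightarrow> v j \<noteq> 0"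
    and dvd: "\<And>j. j \<in> {1..k} \<Longrightarrow> den (v j) dvd den (v (Suc k))"
    and m: "m \<ge> 1"
  shows "nu (Suc k) v m = (\<Prod>j=1..k. 1 / v j - 1) / (of_nat (den (v (Suc k))) * v (Suc k)) * ind (den (v (Suc k))) m - nu k v m"
proof -
  let ?t = "den (v (Suc k))"
  let ?c = "1 / (of_nat ?t * v (Suc k)) * ind ?t m"
  have lcm: "den_Lcm v (insert (Suc k) A) = ?t" if "A \<in> Pow {1..k}" for A
  proof -
    have "den_Lcm v A dvd ?t" unfolding den_Lcm_def by (rule Lcm_least) (use that dvd in auto)
    then show ?thesis by (simp add: lcm_proj1_if_dvd)
  qed
  have summand: "Lambda_coeff v (insert (Suc k) A) * ind (den_Lcm v (insert (Suc k) A)) m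
      = - ?c * (\<Prod>j\<in>A. - (1 / v j))" if A: "A \<in> Pow {1..k}" for A
  proof -
    have fin: "finite A" "Suc k \<notin> A" using A finite_subset by auto
    have "(\<Prod>j\<in>A. - (1 / v j)) = (\<Prod>j\<in>A. (- 1) / v j)" by simp
    also have "\<dots> = (-1) ^ card A / (\<Prod>j\<in>A. v j)" by (subst prod_dividef) simp
    finally have e: "(\<Prod>j\<in>A. - (1 / v j)) = (-1) ^ card A / (\<Prod>j\<in>A. v j)" .
    show ?thesis unfolding lcm[OF A] e unfolding Lambda_coeff_def lcm[OF A] using fin by (simp add: mult_ac)
  qed
  have "(\<Prod>j=1..k. 1 - 1 / v j) = (\<Prod>j=1..k. - (1 / v j) + 1)" by simp
  also have "\<dots> = (\<Sum>A\<in>Pow {1..k}. (\<Prod>j\<in>A. - (1 / v j)) * (\<Prod>j\<in>{1..k} - A. 1))"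
    by (rule prod_add) simp
  \<comment> \<open>Subsets containing the new index share one lcm, so their coefficients differ
    only in these products, whose sum factors over all \<open>j\<close>.\<close>
  finally have expand: "(\<Sum>A\<in>Pow {1..k}. (\<Prod>j\<in>A. - (1 / v j))) = (\<Prod>j=1..k. 1 - 1 / v j)" by simp
  have sgn: "(\<Prod>j=1..k. 1 / v j - 1) = (-1) ^ k * (\<Prod>j=1..k. 1 - 1 / v j)"
  proof -
    have "(\<Prod>j=1..k. 1 / v j - 1) = (\<Prod>j=1..k. (-1) * (1 - 1 / v j))" by (rule prod.cong) auto
    also have "\<dots> = (-1) ^ k * (\<Prod>j=1..k. 1 - 1 / v j)" unfolding prod.distrib by simp
    finally show ?thesis .
  qed
  have "nu (Suc k) v m = (-1) ^ Suc k * (\<Sum>A\<in>Pow (insert (Suc k) {1..k}). Lambda_coeff v A * ind (den_Lcm v A) m)"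
    using nu_eq[of "Suc k" v m] v m by (simp add: atLeastAtMostSuc_conv)
  also have "(\<Sum>A\<in>Pow (insert (Suc k) {1..k}). Lambda_coeff v A * ind (den_Lcm v A) m)
      = (\<Sum>A\<in>Pow {1..k}. Lambda_coeff v A * ind (den_Lcm v A) m)
        + (\<Sum>A\<in>Pow {1..k}. Lambda_coeff v (insert (Suc k) A) * ind (den_Lcm v (insert (Suc k) A)) m)"
    by (rule sum_Pow_insert) auto
  also have "(\<Sum>A\<in>Pow {1..k}. Lambda_coeff v (insert (Suc k) A) * ind (den_Lcm v (insert (Suc k) A)) m)
      = - ?c * (\<Prod>j=1..k. 1 - 1 / v j)"
    unfolding expand[symmetric] sum_distrib_left by (rule sum.cong[OF refl summand])
  also have "(-1) ^ Suc k * ((\<Sum>A\<in>Pow {1..k}. Lambda_coeff v A * ind (den_Lcm v A) m)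
        + - ?c * (\<Prod>j=1..k. 1 - 1 / v j)) = ?c * (\<Prod>j=1..k. 1 / v j - 1) - nu k v m"
  proof -
    have "nu k v m = (-1) ^ k * (\<Sum>A\<in>Pow {1..k}. Lambda_coeff v A * ind (den_Lcm v A) m)"
      using nu_eq[of k v m] v m by simp
    then show ?thesis unfolding sgn by (simp add: algebra_simps)
  qed
  finally show ?thesis by simp
qed

text \<open>\<open>N k\<close> takes its maximum \<open>g k\<close> on Div(t k) - Div(t (k - 1)), so
  every nonempty level contains this layer. Inside Div(t (k - 1)) two steps of the recursion give
  \<open>N (k - 2)\<close> plus a constant, and induction applies with a shifted threshold.\<close>

lemma chain_levels_layered:
  fixes N :: "nat \<Rightarrow> nat \<Rightarrow> rat"
  assumes N0: "\<And>m. m \<ge> 1 \<Longrightarrow> N 0 m = g 0 * ind (t 0) m"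
    and NS: "\<And>k m. k < n \<Longrightarrow> m \<ge> 1 \<Longrightarrow> N (Suc k) m = g (Suc k) * ind (t (Suc k)) m - N k m"
    and t: "\<And>k. k \<le> n \<Longrightarrow> t k > 0" "\<And>k. k < n \<Longrightarrow> t k dvd t (Suc k)"
    and g: "0 \<le> g 0" "\<And>k. k < n \<Longrightarrow> g k \<le> g (Suc k)"
    and k: "k \<le> n" and pos: "\<theta> > 0"
  shows "layered {m. m \<ge> 1 \<and> \<theta> \<le> N k m}"
proof -
  have ind_mono: "ind (t k) m \<le> ind (t (Suc k)) m" if "k < n" for k m
    using t(2)[OF that] unfolding ind_def by (auto dest: dvd_trans)
  have ind_nonneg: "0 \<le> ind d m" for d m unfolding ind_def by simp
  have g0: "0 \<le> g k" if "k \<le> n" for k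
    using that
  proof (induction k)
    case (Suc k)
    then show ?case using g(2)[of k] by simp
  qed (use g(1) in simp)
  \<comment> \<open>Both bounds are proved together: the upper bound for the subtracted term gives
    the lower bound at the next index.\<close>
  have bounds: "0 \<le> N k m \<and> N k m \<le> g k * ind (t k) m" if "k \<le> n" "m \<ge> 1" for k m
    using that
  proof (induction k)
    case 0
    then show ?case using N0 g(1) ind_nonneg by simp
  next
    case (Suc k)
    have "g k * ind (t k) m \<le> g (Suc k) * ind (t (Suc k)) m"
      using g(2)[of k] g0[of "Suc k"] ind_mono[of k m] ind_nonneg Suc.prems by (intro mult_mono) auto
    then show ?case using Suc NS[of k m] by simp
  qed
  have dvd_pos: "m \<ge> 1" if "m dvd t k" "k \<le> n" for m k
    using dvd_pos_nat[OF t(1)[OF that(2)] that(1)] by simp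
  have N_top: "N (Suc k) m = g (Suc k)" if "k < n" "m dvd t (Suc k)" "\<not> m dvd t k" for k m
    using NS[of k m] bounds[of k m] that dvd_pos[of m "Suc k"] by (simp add: ind_def)
  have N_zero: "N k m = 0" if "k \<le> n" "m \<ge> 1" "\<not> m dvd t k" for k m
    using bounds[of k m] that by (simp add: ind_def)
  show ?thesis
    using k pos
  proof (induction k arbitrary: \<theta> rule: less_induct)
    case (less k)
    show ?case
    proof (cases k)
      case 0
      have "{m. m \<ge> 1 \<and> \<theta> \<le> N k m} = (if \<theta> \<le> g 0 then {m. m dvd t 0} else {})"
        using N0 less.prems dvd_pos[of _ 0] unfolding 0 by (auto simp: ind_def split: if_splits)
      then show ?thesis using layered_empty layered_divisors t(1)[of 0] by simp
    next
      case (Suc k')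
      have lt: "k' < n" and le: "k' \<le> n" "k \<le> n" using Suc less.prems by auto
      have mem: "m \<ge> 1 \<and> \<theta> \<le> N k m \<longleftrightarrow> m dvd t k \<and> (m dvd t k' \<longrightarrow> \<theta> \<le> g k - N k' m)"
        if "\<theta> \<le> g k" for m
      proof (cases "m dvd t k")
        case True
        have "m \<ge> 1" using dvd_pos True le by blast
        then show ?thesis
          using NS[of k' m] N_top[of k' m] lt True that unfolding Suc by (auto simp: ind_def)
      next
        case False
        then show ?thesis using N_zero[of k m] le less.prems by force
      qed
      consider "\<theta> > g k" | "\<theta> \<le> g k" by linarith
      then show ?thesis
      proof cases
        case 1
        have "\<not> \<theta> \<le> N k m" if "m \<ge> 1" for m
          using bounds[of k m] N_zero[of k m] that le 1 less.prems(2)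
          by (cases "m dvd t k") (auto simp: ind_def)
        then have e: "{m. m \<ge> 1 \<and> \<theta> \<le> N k m} = {}" by blast
        show ?thesis unfolding e by (rule layered_empty)
      next
        case 2
        define M where "M = {m. m dvd t k' \<and> \<theta> \<le> g k - N k' m}"
        have eq: "{m. m \<ge> 1 \<and> \<theta> \<le> N k m} = {m. m dvd t k \<and> \<not> m dvd t k'} \<union> M"
          using mem[OF 2] t(2)[OF lt] unfolding M_def Suc by (auto dest: dvd_trans)
        have "layered M"
        proof (cases k')
          case 0
          \<comment> \<open>Here \<open>N 0\<close> is constant on Div(t 0), so \<open>M\<close> is
            all of it or empty.\<close>
          have "M = (if \<theta> \<le> g k - g 0 then {m. m dvd t 0} else {})"
            using N0 dvd_pos[of _ 0] unfolding M_def 0 by (auto simp: ind_def)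
          then show ?thesis using layered_empty layered_divisors t(1)[of 0] by simp
        next
          case (Suc i)
          have i: "i < n" "i \<le> n" "i < k" using lt Suc \<open>k = Suc k'\<close> by auto
          \<comment> \<open>On Div(t k') the function is \<open>g k - g k' + N i\<close>, so the
            threshold drops by \<open>g k - g k'\<close>.\<close>
          let ?\<theta> = "\<theta> - (g k - g k')"
          have Nk': "N k' m = g k' - N i m" if "m dvd t k'" for m
            using NS[of i m] that dvd_pos le i(1) unfolding Suc by (simp add: ind_def)
          show ?thesis
          proof (cases "?\<theta> > 0")
            case True
            have "M = {m. m \<ge> 1 \<and> ?\<theta> \<le> N i m}"
            proof (rule set_eqI)
              fix m
              show "m \<in> M \<longleftrightarrow> m \<in> {m. m \<ge> 1 \<and> ?\<theta> \<le> N i m}"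
              proof (cases "m dvd t k'")
                case True
                then show ?thesis using Nk'[OF True] dvd_pos[OF True le(1)] unfolding M_def by auto
              next
                case False
                then have "\<not> m dvd t i" using t(2)[OF i(1)] unfolding Suc by (meson dvd_trans)
                then show ?thesis using N_zero[of i m] i(2) \<open>?\<theta> > 0\<close> False unfolding M_def by force
              qed
            qed
            then show ?thesis using less.IH[OF i(3,2) True] by simp
          next
            case False
            \<comment> \<open>A nonpositive threshold excludes nothing, as \<open>N i\<close> is
              nonnegative; but the level of \<open>N i\<close> itself would then also contain
              numbers outside Div(t k').\<close>
            have "M = {m. m dvd t k'}"
            proof (rule set_eqI)
              fix m
              show "m \<in> M \<longleftrightarrow> m \<in> {m. m dvd t k'}"
              proof (cases "m dvd t k'")
                case True
                then show ?thesis
                  using Nk'[OF True] bounds[of i m] dvd_pos[OF True le(1)] i(2) False unfolding M_def by auto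
              qed (simp add: M_def)
            qed
            then show ?thesis using layered_divisors t(1)[OF le(1)] by simp
          qed
        qed
        then show ?thesis
          unfolding eq using layered.step[OF t(1)[OF le(2)]] t(2)[OF lt] unfolding Suc M_def by blast
      qed
    qed
  qed
qed

section \<open>Levels of explicit combinations of divisor indicators\<close>

lemma layered_two_levels:
  assumes "t > 0" "\<theta> > 0" "\<epsilon> \<in> {-1, 1 :: rat}"
  shows "layered {m. m \<ge> 1 \<and> \<theta> \<le> c * ind t m + \<epsilon> * ind 1 m}"
proof -
  \<comment> \<open>Only m = 1 is perturbed: it may be the sole element of a level or the only
    divisor missing from one.\<close>
  have "{m. m \<ge> 1 \<and> \<theta> \<le> c * ind t m + \<epsilon> * ind 1 m} =
    (if \<theta> \<le> c then if \<theta> \<le> c + \<epsilon> then {m. m dvd t} else {m. m dvd t \<and> \<not> m dvd 1}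
     else if \<theta> \<le> c + \<epsilon> then {m. m dvd 1} else {})" (is "?L = ?R")
  proof (rule set_eqI)
    fix m
    have "m dvd 1 \<Longrightarrow> m dvd t" "m dvd t \<Longrightarrow> m \<ge> 1" using assms(1) by (auto simp: dvd_pos_nat Suc_leI)
    then show "m \<in> ?L \<longleftrightarrow> m \<in> ?R"
      using assms(2,3) unfolding ind_def
      by (cases "m dvd 1"; cases "m dvd t") (auto simp del: nat_dvd_1_iff_1)
  qed
  then show ?thesis
    using layered_empty layered_divisors[OF assms(1)] layered_divisors[of 1]
      layered_proper_divisors[OF assms(1), of 1] by simp
qed

text \<open>On Div(lcm) the value is \<open>G\<close> off Div(a) and Div(b), \<open>G - 1\<close> on
  exactly one of them, and \<open>G - 2\<close> on Div(gcd) except for \<open>G - 1\<close> at 1.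
  Thus the only level that is not a filter is the top layer over Div(gcd) together with 1.\<close>

lemma layered_fermat:
  assumes "a > 0" "b > 0" "\<theta> > 0"
  shows "layered {m. m \<ge> 1 \<and> \<theta> \<le> G * ind (lcm a b) m - ind a m - ind b m + ind 1 m}" (is "layered ?L")
proof -
  have L: "lcm a b > 0" using assms by (simp add: lcm_pos_nat)
  have eq: "m \<in> ?L \<longleftrightarrow> m dvd lcm a b \<and> \<theta> \<le> G \<and> (m dvd a \<or> m dvd b \<longrightarrow> \<theta> \<le> G - 1) \<and>
      (m dvd gcd a b \<longrightarrow> m dvd 1 \<or> \<theta> \<le> G - 2)" for m
  proof -
    have "m dvd 1 \<Longrightarrow> m dvd a" "m dvd 1 \<Longrightarrow> m dvd b" "m dvd a \<Longrightarrow> m dvd lcm a b"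
      "m dvd b \<Longrightarrow> m dvd lcm a b" "m dvd lcm a b \<Longrightarrow> m \<ge> 1"
      using L by (auto simp: dvd_pos_nat Suc_leI)
    then show ?thesis
      using assms(3) unfolding ind_def mem_Collect_eq gcd_greatest_iff
      by (cases "m dvd 1"; cases "m dvd a"; cases "m dvd b"; cases "m dvd lcm a b")
        (auto simp del: nat_dvd_1_iff_1)
  qed
  consider "\<theta> \<le> G - 2" | "G - 2 < \<theta>" "\<theta> \<le> G - 1" | "G - 1 < \<theta>" by linarith
  then show ?thesis
  proof cases
    case 1
    then have "?L = {m. m dvd lcm a b}" using eq by auto
    then show ?thesis using layered_divisors[OF L] by simp
  next
    case 2
    have "?L = {m. m dvd lcm a b \<and> \<not> m dvd gcd a b} \<union> {m. m dvd 1}"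
      by (rule set_eqI) (use eq 2 in auto)
    then show ?thesis
      using layered.step[OF L _ layered_divisors[of 1], of "gcd a b"] by auto
  next
    case 3
    have "upclosed (lcm a b) ?L"
      by (rule upclosedI; unfold eq) (use 3 dvd_trans in fastforce)+
    then show ?thesis using layered.up[OF L] by blast
  qed
qed

text \<open>The value on Div(gcd b c) is \<open>C - g - h\<close>, raised by 1 on Div(a) - {1}.
  Because \<open>g\<close> and \<open>h\<close> are at least 1, the raised value does not exceed
  \<open>C - g\<close> or \<open>C - h\<close>, so a level meeting the raised part contains
  everything outside Div(gcd b c).\<close>

lemma layered_type_III:
  assumes "b > 0" "c > 0" "a dvd b" "a dvd c" "\<theta> > 0" "g \<ge> 1" "h \<ge> 1"
  shows "layered {m. m \<ge> 1 \<and> \<theta> \<le> C * ind (lcm b c) m - g * ind b m - h * ind c m + ind a m - ind 1 m}"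
    (is "layered ?L")
proof -
  have L: "lcm b c > 0" using assms by (simp add: lcm_pos_nat)
  have a: "a > 0" using assms dvd_pos_nat by blast
  have eq: "m \<in> ?L \<longleftrightarrow> m dvd lcm b c \<and> \<theta> \<le> C \<and> (m dvd b \<longrightarrow> \<theta> \<le> C - g) \<and> (m dvd c \<longrightarrow> \<theta> \<le> C - h) \<and>
      (m dvd gcd b c \<longrightarrow> \<theta> \<le> C - g - h + (if m dvd a \<and> \<not> m dvd 1 then 1 else 0))" for m
  proof -
    have "m dvd 1 \<Longrightarrow> m dvd a" "m dvd a \<Longrightarrow> m dvd b" "m dvd a \<Longrightarrow> m dvd c" "m dvd b \<Longrightarrow> m dvd lcm b c"
      "m dvd c \<Longrightarrow> m dvd lcm b c" "m dvd lcm b c \<Longrightarrow> m \<ge> 1"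
      using L assms(3,4) by (auto simp: dvd_pos_nat Suc_leI intro: dvd_trans)
    then show ?thesis
      using assms(5-7) unfolding ind_def mem_Collect_eq gcd_greatest_iff
      by (cases "m dvd 1"; cases "m dvd a"; cases "m dvd b"; cases "m dvd c"; cases "m dvd lcm b c")
        (auto simp del: nat_dvd_1_iff_1)
  qed
  consider "\<theta> \<le> C - g - h" | "C - g - h < \<theta>" "\<theta> \<le> C - g - h + 1" | "C - g - h + 1 < \<theta>" by linarith
  then show ?thesis
  proof cases
    case 1
    then have "?L = {m. m dvd lcm b c}" unfolding set_eq_iff eq using assms(6,7) by auto
    then show ?thesis using layered_divisors[OF L] by simp
  next
    case 2
    have "?L = {m. m dvd lcm b c \<and> \<not> m dvd gcd b c} \<union> {m. m dvd a \<and> \<not> m dvd 1}"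
      unfolding set_eq_iff eq using assms(3,4,6,7) 2
      by (auto simp del: nat_dvd_1_iff_1 split: if_splits intro: dvd_trans)
    moreover have "layered \<dots>"
      using layered.step[OF L _ layered_proper_divisors[OF a, of 1], of "gcd b c"] assms(3,4)
      by (auto intro: dvd_trans)
    ultimately show ?thesis by simp
  next
    case 3
    have "upclosed (lcm b c) ?L"
    proof (rule upclosedI)
      show "m dvd lcm b c" if "m \<in> ?L" for m using that unfolding eq by blast
      fix m m' assume m: "m \<in> ?L" and m': "m dvd m'" "m' dvd lcm b c"
      have "\<not> m dvd gcd b c" using m 3 unfolding eq by (auto split: if_splits)
      then have "\<not> m' dvd gcd b c" using m'(1) dvd_trans by blast
      then show "m' \<in> ?L" using m m' dvd_trans unfolding eq by blast
    qed
    then show ?thesis using layered.up[OF L] by blast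
  qed
qed

text \<open>For \<open>0 < \<rho> < 1\<close> the levels \<open>G\<close> and \<open>G - \<rho> + 1\<close> would come in the wrong order.\<close>

lemma layered_type_IV:
  assumes "a > 0" "t > 0" "\<theta> > 0" "\<rho> = 0 \<or> \<rho> \<ge> 1"
  shows "layered {m. m \<ge> 1 \<and> \<theta> \<le> G * ind (lcm a t) m - \<rho> * ind t m + ind a m - ind 1 m}"
    (is "layered ?L")
proof -
  have L: "lcm a t > 0" using assms by (simp add: lcm_pos_nat)
  have eq: "m \<in> ?L \<longleftrightarrow> m dvd lcm a t \<and>
      \<theta> \<le> G - (if m dvd t then \<rho> else 0) + (if m dvd a \<and> \<not> m dvd 1 then 1 else 0)" for m
  proof -
    have "m dvd 1 \<Longrightarrow> m dvd a" "m dvd a \<Longrightarrow> m dvd lcm a t" "m dvd t \<Longrightarrow> m dvd lcm a t"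
      "m dvd lcm a t \<Longrightarrow> m \<ge> 1"
      using L by (auto simp: dvd_pos_nat Suc_leI)
    then show ?thesis
      using assms(3) unfolding ind_def mem_Collect_eq
      by (cases "m dvd 1"; cases "m dvd a"; cases "m dvd t"; cases "m dvd lcm a t")
        (auto simp del: nat_dvd_1_iff_1)
  qed
  show ?thesis
  proof (cases "\<rho> = 0")
    case True
    have "?L = (if \<theta> \<le> G then {m. m dvd lcm a t} else if \<theta> \<le> G + 1 then {m. m dvd a \<and> \<not> m dvd 1} else {})"
      unfolding set_eq_iff eq using True by (auto simp del: nat_dvd_1_iff_1)
    then show ?thesis
      using layered_empty layered_divisors[OF L] layered_proper_divisors[OF assms(1), of 1] by simp
  next
    case False
    then have \<rho>: "\<rho> \<ge> 1" using assms(4) by simp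
    \<comment> \<open>The values are \<open>G + 1\<close> on Div(a) - Div(t), \<open>G\<close> off
      both sets, \<open>G - \<rho> + 1\<close> on their common divisors other than 1, and
      \<open>G - \<rho>\<close> on the rest of Div(t).\<close>
    consider "\<theta> \<le> G - \<rho>" | "G - \<rho> < \<theta>" "\<theta> \<le> G - \<rho> + 1" | "G - \<rho> + 1 < \<theta>" "\<theta> \<le> G"
      | "G < \<theta>" "\<theta> \<le> G + 1" | "G + 1 < \<theta>" by linarith
    then show ?thesis
    proof cases
      case 1
      then have "?L = {m. m dvd lcm a t}" unfolding set_eq_iff eq using \<rho> by auto
      then show ?thesis using layered_divisors[OF L] by simp
    next
      case 2
      have "?L = {m. m dvd lcm a t \<and> \<not> m dvd t} \<union> {m. m dvd gcd a t \<and> \<not> m dvd 1}"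
      proof (rule set_eqI)
        fix m
        have "m dvd a \<Longrightarrow> m dvd lcm a t" "m dvd t \<Longrightarrow> m dvd lcm a t" by simp_all
        then show "m \<in> ?L \<longleftrightarrow> m \<in> {m. m dvd lcm a t \<and> \<not> m dvd t} \<union> {m. m dvd gcd a t \<and> \<not> m dvd 1}"
          unfolding eq using \<rho> 2
          by (cases "m dvd 1"; cases "m dvd a"; cases "m dvd t"; cases "m dvd lcm a t")
            (simp_all del: nat_dvd_1_iff_1 dvd_lcm1 dvd_lcm2)
      qed
      moreover have "layered \<dots>"
      proof (rule layered.step[OF L])
        show "layered {m. m dvd gcd a t \<and> \<not> m dvd 1}"
          using assms(1) by (intro layered_proper_divisors) auto
      qed auto
      ultimately show ?thesis by (simp only:)
    next
      case 3
      have "?L = {m. m dvd lcm a t \<and> \<not> m dvd t}" unfolding set_eq_iff eq using \<rho> 3 by auto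
      then show ?thesis using layered_proper_divisors[OF L] by simp
    next
      case 4
      have "?L = {m. m dvd a \<and> \<not> m dvd t}" unfolding set_eq_iff eq using \<rho> 4 by auto
      moreover have "upclosed a {m. m dvd a \<and> \<not> m dvd t}" by (rule upclosed_diff)
      ultimately show ?thesis using layered.up[OF assms(1)] by simp
    next
      case 5
      then have e: "?L = {}" unfolding set_eq_iff eq using \<rho> by auto
      show ?thesis unfolding e by (rule layered_empty)
    qed
  qed
qed

text \<open>The values \<open>e\<close>, \<open>e - c\<close>, \<open>e - c - 1\<close> on Div(s) -
  Div(t), Div(t) - {1} and {1} decrease towards 1.\<close>

lemma layered_type_VI:
  assumes "s > 0" "t dvd s" "\<theta> > 0" "c \<ge> 0"
  shows "layered {m. m \<ge> 1 \<and> \<theta> \<le> e * ind s m - c * ind t m - ind 1 m}" (is "layered ?L")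
proof -
  have "?L = (if \<theta> \<le> e - c - 1 then {m. m dvd s} else if \<theta> \<le> e - c then {m. m dvd s \<and> \<not> m dvd 1}
      else if \<theta> \<le> e then {m. m dvd s \<and> \<not> m dvd t} else {})" (is "_ = ?R")
  proof (rule set_eqI)
    fix m
    have "m dvd 1 \<Longrightarrow> m dvd t" "m dvd t \<Longrightarrow> m dvd s" "m dvd s \<Longrightarrow> m \<ge> 1"
      using assms(1,2) by (auto simp: dvd_pos_nat Suc_leI intro: dvd_trans)
    then show "m \<in> ?L \<longleftrightarrow> m \<in> ?R"
      using assms(3,4) unfolding ind_def
      by (cases "m dvd 1"; cases "m dvd t"; cases "m dvd s") (auto simp del: nat_dvd_1_iff_1)
  qed
  then show ?thesis
    using layered_empty layered_divisors[OF assms(1)] layered_proper_divisors[OF assms(1), of 1]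
      layered_proper_divisors[OF assms(1,2)] by simp
qed

section \<open>The types of weight systems\<close>

lemma den_mult_Ints: "of_nat (den q) * q \<in> \<int>"
  using den_dvd_iff[of q "den q"] by simp

text \<open>\<open>y\<close> is an integer combination of 1 and \<open>x\<close>.\<close>

lemma den_dvd_den:
  assumes "of_nat a * x + y = 1"
  shows "den y dvd den x"
  unfolding den_dvd_iff
proof -
  have y: "y = 1 - of_nat a * x" using assms by simp
  have "of_nat (den x) * y = of_nat (den x) - of_nat a * (of_nat (den x) * x)"
    unfolding y by (simp add: algebra_simps)
  then show "of_nat (den x) * y \<in> \<int>" using den_mult_Ints[of x] by simp
qed

lemma den_dvd_mult:
  assumes "of_nat a * x + y = 1"
  shows "den x dvd a * den y"
  unfolding den_dvd_iff
proof -
  have "of_nat (a * den y) * x = of_nat (den y) * (of_nat a * x)" by simp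
  also have "of_nat a * x = 1 - y" using assms by simp
  also have "of_nat (den y) * (1 - y) = of_nat (den y) - of_nat (den y) * y" by (simp add: algebra_simps)
  finally show "of_nat (a * den y) * x \<in> \<int>" using den_mult_Ints[of y] by simp
qed

lemma den_le:
  assumes "of_nat a * x + y = 1" "a \<ge> 1"
  shows "(of_nat (den x) :: rat) \<le> of_nat a * of_nat (den y)"
proof -
  have "den x \<le> a * den y" using den_dvd_mult[OF assms(1)] assms(2) den_pos[of y] by (intro dvd_imp_le) auto
  then show ?thesis by (metis of_nat_le_iff of_nat_mult)
qed

text \<open>The left side is a positive integer, and it is at most 1 since \<open>den x\<close>
  divides \<open>a\<close>.\<close>

lemma den_unit_fraction:
  assumes "of_nat a * x = (1::rat)"
  shows "of_nat (den x) * x = 1"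
proof -
  have x: "x > 0" using assms by (metis mult_nonneg_nonpos not_one_le_zero of_nat_0_le_iff not_le)
  have "a \<ge> 1" using assms by (cases a) auto
  have "(of_nat (den x) :: rat) \<le> of_nat a"
    using den_dvd_iff[of x a] assms \<open>a \<ge> 1\<close> by (simp add: dvd_imp_le)
  then have le: "of_nat (den x) * x \<le> 1" using assms x mult_right_mono[of _ _ x] by fastforce
  obtain i where i: "of_nat (den x) * x = of_int i" using den_mult_Ints by (auto elim: Ints_cases)
  moreover have "of_nat (den x) * x > 0" using x den_pos[of x] by simp
  ultimately have "i = 1" using le by simp
  then show ?thesis using i by simp
qed

section \<open>The individual types\<close>

definition weights :: "nat \<Rightarrow> (nat \<Rightarrow> rat) \<Rightarrow> bool" where
  "weights n v \<longleftrightarrow> (\<forall>i\<in>{1..n}. 0 < v i \<and> v i < 1)"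

definition layered_levels :: "nat \<Rightarrow> (nat \<Rightarrow> rat) \<Rightarrow> bool" where
  "layered_levels n v \<longleftrightarrow> (\<forall>\<theta>>0. layered {m. m \<ge> 1 \<and> \<theta> \<le> nu n v m})"

lemma layered_levelsI:
  assumes "\<And>m. m \<ge> 1 \<Longrightarrow> nu n v m = f m" "\<And>\<theta>. \<theta> > 0 \<Longrightarrow> layered {m. m \<ge> 1 \<and> \<theta> \<le> f m}"
  shows "layered_levels n v"
proof -
  have "{m. m \<ge> 1 \<and> \<theta> \<le> nu n v m} = {m. m \<ge> 1 \<and> \<theta> \<le> f m}" for \<theta>
    using assms(1) by auto
  then show ?thesis unfolding layered_levels_def using assms(2) by simp
qed

text \<open>Each denominator divides the next, so \<open>nu_Suc\<close> yields the recursion.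
  Moreover \<open>g (k + 1)\<close> is \<open>g k\<close> times
  \<open>a (k + 1) * t k / t (k + 1)\<close>, and \<open>den_le\<close> makes this factor at least
  1.\<close>

lemma chain_layered_levels:
  assumes v: "weights n v" and a: "\<And>j. j \<in> {1..n} \<Longrightarrow> a j \<ge> 1"
    and first: "of_nat (a 1) * v 1 = 1"
    and chain: "\<And>j. j \<in> {2..n} \<Longrightarrow> of_nat (a j) * v j + v (j - 1) = 1"
  shows "layered_levels n v"
proof -
  \<comment> \<open>The values 1 of \<open>t\<close> and \<open>g\<close> at index 0 match the empty
    product, whose nu is the indicator of m = 1.\<close>
  define t where "t = (\<lambda>k. if k = 0 then 1 else den (v k))"
  define P where "P = (\<lambda>k. \<Prod>j=1..k. 1 / v j - 1)"
  define g where "g = (\<lambda>k. if k = 0 then 1 else P (k - 1) / (of_nat (t k) * v k))"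
  have v0: "v j \<noteq> 0" "0 < v j" "v j < 1" if "j \<in> {1..n}" for j
    using v that unfolding weights_def by force+
  have tpos: "t k > 0" for k unfolding t_def using den_pos by simp
  have rel: "of_nat (a (Suc k)) * v (Suc k) + v k = 1" if "k \<noteq> 0" "k < n" for k
    using chain[of "Suc k"] that by simp
  have tdvd: "t k dvd t (Suc k)" if "k < n" for k
    using den_dvd_den[OF rel[of k]] that unfolding t_def by simp
  have t_le: "t j dvd t k" if "j \<le> k" "k \<le> n" for j k
    using that
  proof (induction k)
    case (Suc k)
    then show ?case using tdvd[of k] by (cases "j = Suc k") (auto intro: dvd_trans)
  qed simp
  have P0: "0 \<le> P k" if "k \<le> n" for k
    unfolding P_def
  proof (rule prod_nonneg)
    fix j assume "j \<in> {1..k}"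
    then have "j \<in> {1..n}" using that by auto
    then show "0 \<le> 1 / v j - 1" using v0[of j] by (simp add: field_simps)
  qed
  have gmono: "g k \<le> g (Suc k)" if k: "k < n" for k
  proof (cases "k = 0")
    case True
    have "of_nat (den (v 1)) * v 1 = 1" by (rule den_unit_fraction[OF first])
    then show ?thesis using True unfolding g_def P_def t_def by simp
  next
    case False
    then obtain l where l: "k = Suc l" by (cases k) auto
    have vk: "v k > 0" "v (Suc k) > 0" using v0[of k] v0[of "Suc k"] k l by auto
    \<comment> \<open>The chain relation turns the factor \<open>1 / v k - 1\<close> into a multiple
      of \<open>v (Suc k)\<close>, which then cancels in \<open>g (Suc k)\<close>.\<close>
    have PS: "P k = P l * (of_nat (a (Suc k)) * v (Suc k) / v k)"
    proof -
      have "P k = P l * (1 / v k - 1)" unfolding P_def l by (simp add: prod.cl_ivl_Suc)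
      moreover have "1 / v k - 1 = of_nat (a (Suc k)) * v (Suc k) / v k"
        using rel[OF False k] vk by (simp add: field_simps)
      ultimately show ?thesis by simp
    qed
    have tt: "(of_nat (t (Suc k)) :: rat) \<le> of_nat (a (Suc k)) * of_nat (t k)"
      using den_le[OF rel[OF False k]] a[of "Suc k"] k False unfolding t_def by simp
    have pos: "(of_nat (t k) :: rat) > 0" "(of_nat (t (Suc k)) :: rat) > 0" using tpos by auto
    have "1 / of_nat (t k) \<le> of_nat (a (Suc k)) / (of_nat (t (Suc k)) :: rat)"
      using tt pos by (simp add: field_simps)
    then have "P l / v k * (1 / of_nat (t k)) \<le> P l / v k * (of_nat (a (Suc k)) / of_nat (t (Suc k)))"
      using P0[of l] k l vk by (intro mult_left_mono) auto
    moreover have "g k = P l / v k * (1 / of_nat (t k))"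
      unfolding g_def l by simp
    moreover have "g (Suc k) = P l / v k * (of_nat (a (Suc k)) / of_nat (t (Suc k)))"
      unfolding g_def using PS vk by simp
    ultimately show ?thesis by simp
  qed
  have N0: "nu 0 v m = g 0 * ind (t 0) m" if "m \<ge> 1" for m
    using nu_0[OF that] unfolding g_def t_def by simp
  have NS: "nu (Suc k) v m = g (Suc k) * ind (t (Suc k)) m - nu k v m" if "k < n" "m \<ge> 1" for k m
  proof -
    have "den (v j) dvd den (v (Suc k))" if "j \<in> {1..k}" for j
      using t_le[of j "Suc k"] that \<open>k < n\<close> unfolding t_def by simp
    then show ?thesis
      using nu_Suc[of k v m] v0 that unfolding g_def t_def P_def by simp
  qed
  show ?thesis
    unfolding layered_levels_def
    by (intro allI impI chain_levels_layered[where N = "\<lambda>k. nu k v" and g = g and t = t and n = n])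
      (use N0 NS tpos tdvd gmono in \<open>auto simp: g_def\<close>)
qed

text \<open>With equal denominators, adjoining a weight changes only the multiple of Lambda_t and
  flips the sign of the Lambda_1 term.\<close>

lemma equal_den_nu:
  assumes v: "weights n v" and den: "\<And>j. j \<in> {1..n} \<Longrightarrow> den (v j) = t"
  shows "k \<le> n \<Longrightarrow> \<exists>c. \<forall>m\<ge>1. nu k v m = c * ind t m + (-1) ^ k * ind 1 m"
proof (induction k)
  case 0
  then show ?case using nu_0 by (intro exI[of _ 0]) simp
next
  case (Suc k)
  then obtain c where c: "\<And>m. m \<ge> 1 \<Longrightarrow> nu k v m = c * ind t m + (-1) ^ k * ind 1 m" by auto
  let ?d = "(\<Prod>j=1..k. 1 / v j - 1) / (of_nat t * v (Suc k))"
  have "nu (Suc k) v m = (?d - c) * ind t m + (-1) ^ Suc k * ind 1 m" if "m \<ge> 1" for m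
  proof -
    have "nu (Suc k) v m = (\<Prod>j=1..k. 1 / v j - 1) / (of_nat (den (v (Suc k))) * v (Suc k)) * ind (den (v (Suc k))) m - nu k v m"
    proof (rule nu_Suc[OF _ _ that])
      show "v j \<noteq> 0" if "j \<in> {1..Suc k}" for j
        using v that Suc.prems unfolding weights_def by force
      show "den (v j) dvd den (v (Suc k))" if "j \<in> {1..k}" for j
        using den[of j] den[of "Suc k"] that Suc.prems by simp
    qed
    then show ?thesis using c[OF that] den[of "Suc k"] Suc.prems by (simp add: algebra_simps)
  qed
  then show ?case by blast
qed

text \<open>Each denominator divides the next around the cycle, so all of them coincide.\<close>

lemma cycle_layered_levels:
  assumes n: "n \<ge> 1" and v: "weights n v"
    and cycle: "\<And>j. j \<in> {1..n} \<Longrightarrow> of_nat (a j) * v j + v (if j = 1 then n else j - 1) = 1"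
  shows "layered_levels n v"
proof -
  have up: "den (v 1) dvd den (v j) \<and> den (v j) dvd den (v n)" if "j \<in> {1..n}" for j
  proof
    have step: "den (v j) dvd den (v (Suc j))" if "j \<ge> 1" "j < n" for j
      using den_dvd_den[OF cycle[of "Suc j"]] that by simp
    have le: "den (v i) dvd den (v j)" if "i \<ge> 1" "i \<le> j" "j \<le> n" for i j
      using that(2,3)
    proof (induction j rule: dec_induct)
      case (step k)
      then show ?case using step(1) that(1) \<open>\<And>j. j \<ge> 1 \<Longrightarrow> j < n \<Longrightarrow> den (v j) dvd den (v (Suc j))\<close>[of k]
        by (meson Suc_leD Suc_le_lessD dvd_trans le_trans)
    qed simp
    show "den (v 1) dvd den (v j)" "den (v j) dvd den (v n)" using le that by auto
  qed
  have "den (v n) dvd den (v 1)" using den_dvd_den[OF cycle[of 1]] n by simp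
  then have "den (v j) = den (v 1)" if "j \<in> {1..n}" for j
    using up[OF that] by (meson dvd_antisym dvd_trans)
  from equal_den_nu[OF v this, of n] obtain c
    where c: "\<And>m. m \<ge> 1 \<Longrightarrow> nu n v m = c * ind (den (v 1)) m + (-1) ^ n * ind 1 m" by auto
  show ?thesis
  proof (rule layered_levelsI[OF c])
    fix \<theta> :: rat assume "\<theta> > 0"
    then show "layered {m. m \<ge> 1 \<and> \<theta> \<le> c * ind (den (v 1)) m + (-1) ^ n * ind 1 m}"
      using layered_two_levels[OF den_pos, of \<theta> "(-1) ^ n"] by (cases "even n") auto
  qed
qed

lemma nu_2:
  assumes "weights 2 v" "m \<ge> 1"
  shows "nu 2 v m = ind 1 m - ind (den (v 1)) m / (of_nat (den (v 1)) * v 1)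
    - ind (den (v 2)) m / (of_nat (den (v 2)) * v 2)
    + ind (lcm (den (v 1)) (den (v 2))) m / (of_nat (lcm (den (v 1)) (den (v 2))) * (v 1 * v 2))"
proof -
  have set: "{1..2} = insert 2 (insert (1::nat) {})" by auto
  have nz: "v j \<noteq> 0" if "j \<in> {1..2}" for j using assms(1) that unfolding weights_def by force
  have "nu 2 v m = (-1) ^ 2 * (\<Sum>A\<in>Pow {1..2}. Lambda_coeff v A * ind (den_Lcm v A) m)"
    by (rule nu_eq[OF nz assms(2)])
  then show ?thesis
    unfolding set by (simp add: sum_Pow_insert Lambda_coeff_def lcm.commute mult_ac)
qed

lemma nu_3:
  assumes "weights 3 v" "m \<ge> 1"
  defines "d \<equiv> \<lambda>j. den (v j)"
  shows "nu 3 v m = - ind 1 m + ind (d 1) m / (of_nat (d 1) * v 1)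
    + ind (d 2) m / (of_nat (d 2) * v 2) + ind (d 3) m / (of_nat (d 3) * v 3)
    - ind (lcm (d 1) (d 2)) m / (of_nat (lcm (d 1) (d 2)) * (v 1 * v 2))
    - ind (lcm (d 1) (d 3)) m / (of_nat (lcm (d 1) (d 3)) * (v 1 * v 3))
    - ind (lcm (d 2) (d 3)) m / (of_nat (lcm (d 2) (d 3)) * (v 2 * v 3))
    + ind (lcm (d 1) (lcm (d 2) (d 3))) m / (of_nat (lcm (d 1) (lcm (d 2) (d 3))) * (v 1 * v 2 * v 3))"
proof -
  have set: "{1..3} = insert 3 (insert 2 (insert (1::nat) {}))" by auto
  have nz: "v j \<noteq> 0" if "j \<in> {1..3}" for j using assms(1) that unfolding weights_def by force
  have "nu 3 v m = (-1) ^ 3 * (\<Sum>A\<in>Pow {1..3}. Lambda_coeff v A * ind (den_Lcm v A) m)"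
    by (rule nu_eq[OF nz assms(2)])
  then show ?thesis
    unfolding set d_def by (simp add: sum_Pow_insert Lambda_coeff_def lcm.commute lcm.left_commute lcm.assoc mult_ac)
qed

lemma fermat_layered_levels:
  assumes v: "weights 2 v" and a: "of_nat a * v 1 = 1" "of_nat b * v 2 = 1"
  shows "layered_levels 2 v"
proof -
  let ?L = "lcm (den (v 1)) (den (v 2))"
  have d: "of_nat (den (v 1)) * v 1 = 1" "of_nat (den (v 2)) * v 2 = 1"
    using den_unit_fraction a by auto
  show ?thesis
  proof (rule layered_levelsI)
    fix m :: nat assume m: "m \<ge> 1"
    show "nu 2 v m = 1 / (of_nat ?L * (v 1 * v 2)) * ind ?L m - ind (den (v 1)) m - ind (den (v 2)) m + ind 1 m"
      unfolding nu_2[OF v m] d by simp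
  qed (intro layered_fermat den_pos)
qed

lemma type_III_layered_levels:
  fixes a :: "nat \<Rightarrow> nat"
  assumes v: "weights 3 v" and a: "a 1 \<ge> 1" "a 2 \<ge> 1" "a 3 \<ge> 1"
    and eqs: "of_nat (a 1) * v 1 = 1" "of_nat (a 2) * v 2 + v 1 = 1" "of_nat (a 3) * v 3 + v 1 = 1"
  shows "layered_levels 3 v"
proof -
  let ?t = "\<lambda>j. den (v j)"
  have pos: "v 1 > 0" "v 2 > 0" "v 3 > 0" using v unfolding weights_def by auto
  have d1: "of_nat (?t 1) * v 1 = 1" using den_unit_fraction eqs(1) by auto
  have dvd: "?t 1 dvd ?t 2" "?t 1 dvd ?t 3" using den_dvd_den[OF eqs(2)] den_dvd_den[OF eqs(3)] by auto
  have lcms: "lcm (?t 1) (?t 2) = ?t 2" "lcm (?t 1) (?t 3) = ?t 3"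
    "lcm (?t 1) (lcm (?t 2) (?t 3)) = lcm (?t 2) (?t 3)"
    using dvd by (auto simp: lcm_proj2_if_dvd dvd_lcmI1)
  \<comment> \<open>From t_j <= a_j t_1 and t_1 v_1 = 1 follows t_j v_1 <= a_j; multiply by v_j and
    use a_j v_j = 1 - v_1.\<close>
  have g: "(1 / v 1 - 1) / (of_nat (?t j) * v j) \<ge> 1"
    if "of_nat (a j) * v j + v 1 = 1" "a j \<ge> 1" "v j > 0" for j
  proof -
    have "of_nat (?t j) * v 1 \<le> of_nat (a j)"
    proof -
      have "of_nat (?t j) * v 1 \<le> of_nat (a j) * of_nat (?t 1) * v 1"
        using den_le[OF that(1,2)] pos(1) by (intro mult_right_mono) auto
      then show ?thesis using d1 by (simp add: mult.assoc)
    qed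
    then have "of_nat (?t j) * v 1 * v j \<le> of_nat (a j) * v j"
      using that(3) by (intro mult_right_mono) auto
    also have "\<dots> = 1 - v 1" using that(1) by simp
    finally show ?thesis
      using pos(1) that(3) den_pos[of "v j"] by (simp add: field_simps)
  qed
  let ?g = "\<lambda>j. (1 / v 1 - 1) / (of_nat (?t j) * v j)"
  let ?L = "lcm (?t 2) (?t 3)"
  define C where "C = 1 / (of_nat ?L * (v 1 * v 2 * v 3)) - 1 / (of_nat ?L * (v 2 * v 3))"
  show ?thesis
  proof (rule layered_levelsI)
    fix m :: nat assume m: "m \<ge> 1"
    \<comment> \<open>The subsets {j} and {1, j} have the same lcm t_j; merging their terms produces
      the coefficient -g_j.\<close>
    have "x / (t * y) - x / (t * (v 1 * y)) = - ((1 / v 1 - 1) / (t * y) * x)"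
      if "t \<noteq> 0" "y \<noteq> 0" for x t y :: rat
      using that pos(1) by (simp add: field_simps)
    from this[of "of_nat (?t 2)" "v 2" "ind (?t 2) m"] this[of "of_nat (?t 3)" "v 3" "ind (?t 3) m"]
    show "nu 3 v m = C * ind ?L m - ?g 2 * ind (?t 2) m - ?g 3 * ind (?t 3) m + ind (?t 1) m - ind 1 m"
      unfolding nu_3[OF v m] lcms d1 C_def using pos den_pos[of "v 2"] den_pos[of "v 3"]
      by (simp add: left_diff_distrib)
  next
    fix \<theta> :: rat assume "\<theta> > 0"
    then show "layered {m. m \<ge> 1 \<and> \<theta> \<le> C * ind ?L m - ?g 2 * ind (?t 2) m - ?g 3 * ind (?t 3) m + ind (?t 1) m - ind 1 m}"
      using g[of 2] g[of 3] eqs a pos dvd den_pos by (intro layered_type_III) auto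
  qed
qed

text \<open>The denominators of \<open>v 2\<close> and \<open>v 3\<close> agree, and the merged
  coefficient of their indicator is minus a natural number, hence minus 0 or minus at least 1, as
  \<open>layered_type_IV\<close> demands.\<close>

lemma type_IV_layered_levels:
  fixes a :: "nat \<Rightarrow> nat"
  assumes v: "weights 3 v" and a: "a 2 \<ge> 1" "a 3 \<ge> 1"
    and eqs: "of_nat (a 1) * v 1 = 1" "of_nat (a 2) * v 2 + v 3 = 1" "of_nat (a 3) * v 3 + v 2 = 1"
  shows "layered_levels 3 v"
proof -
  let ?t = "\<lambda>j. den (v j)"
  have pos: "v 1 > 0" "v 2 > 0" "v 3 > 0" using v unfolding weights_def by auto
  have d1: "of_nat (?t 1) * v 1 = 1" using den_unit_fraction eqs(1) by auto
  have d23: "?t 3 = ?t 2" using den_dvd_den[OF eqs(2)] den_dvd_den[OF eqs(3)] dvd_antisym by blast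
  let ?L = "lcm (?t 1) (?t 2)"
  \<comment> \<open>The determinant of the linear system for \<open>v 2\<close> and
    \<open>v 3\<close>. Elimination gives \<open>K * v 3 = a 2 - 1\<close>, so their common
    denominator divides \<open>K\<close>.\<close>
  define K where "K = a 2 * a 3 - 1"
  have K: "of_nat K = (of_nat (a 2) * of_nat (a 3) - 1 :: rat)"
    unfolding K_def using a by (simp add: of_nat_diff Suc_le_eq)
  have "of_nat K * v 3 = of_nat (a 2) * (of_nat (a 3) * v 3) - v 3" unfolding K by (simp add: algebra_simps)
  also have "of_nat (a 3) * v 3 = 1 - v 2" using eqs(3) by simp
  also have "of_nat (a 2) * (1 - v 2) - v 3 = of_nat (a 2) - 1" using eqs(2) by (simp add: algebra_simps)
  finally have "of_nat K * v 3 \<in> \<int>" by simp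
  then have "?t 2 dvd K" using den_dvd_iff[of "v 3" K] d23 by simp
  then obtain r where r: "K = ?t 2 * r" by blast
  \<comment> \<open>The product of the two cycle relations identifies \<open>r\<close>, the quotient
    of \<open>K\<close> by the denominator, with the merged coefficient.\<close>
  have Kv: "of_nat K * (v 2 * v 3) = 1 - v 2 - v 3"
  proof -
    have "of_nat K * (v 2 * v 3) = (of_nat (a 2) * v 2) * (of_nat (a 3) * v 3) - v 2 * v 3"
      unfolding K by (simp add: algebra_simps)
    also have "of_nat (a 2) * v 2 = 1 - v 3" using eqs(2) by simp
    also have "of_nat (a 3) * v 3 = 1 - v 2" using eqs(3) by simp
    finally show ?thesis by (simp add: algebra_simps)
  qed
  have tpos: "(of_nat (?t 2) :: rat) \<noteq> 0" using den_pos[of "v 2"] by simp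
  have rv: "of_nat r = (1 - v 2 - v 3) / (of_nat (?t 2) * (v 2 * v 3))"
    using Kv pos tpos unfolding r by (simp add: field_simps)
  have \<rho>: "(of_nat r :: rat) = 0 \<or> (of_nat r :: rat) \<ge> 1" by (cases r) auto
  define G where "G = 1 / (of_nat ?L * (v 1 * v 2 * v 3)) - 1 / (of_nat ?L * (v 1 * v 2)) - 1 / (of_nat ?L * (v 1 * v 3))"
  have rho: "x / (of_nat (?t 2) * v 2) + x / (of_nat (?t 2) * v 3) - x / (of_nat (?t 2) * (v 2 * v 3)) = - (of_nat r * x)" for x
    unfolding rv using pos tpos by (simp add: field_simps)
  show ?thesis
  proof (rule layered_levelsI)
    fix m :: nat assume m: "m \<ge> 1"
    show "nu 3 v m = G * ind ?L m - of_nat r * ind (?t 2) m + ind (?t 1) m - ind 1 m"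
      using rho[of "ind (?t 2) m"] unfolding nu_3[OF v m] d23 d1 G_def
      by (simp add: left_diff_distrib)
  qed (intro layered_type_IV den_pos \<rho>)
qed

text \<open>The denominators of \<open>v 1\<close> and \<open>v 2\<close> agree and divide that of
  \<open>v 3\<close>, so \<open>nu_Suc\<close> adjoins the weights one by one.\<close>

lemma type_VI_layered_levels:
  fixes a :: "nat \<Rightarrow> nat"
  assumes v: "weights 3 v" and a: "a 1 \<ge> 1"
    and eqs: "of_nat (a 1) * v 1 + v 2 = 1" "of_nat (a 2) * v 2 + v 1 = 1" "of_nat (a 3) * v 3 + v 1 = 1"
  shows "layered_levels 3 v"
proof -
  let ?t = "\<lambda>j. den (v j)"
  have pos: "v 1 > 0" "v 2 > 0" "v 3 > 0" using v unfolding weights_def by auto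
  have d12: "?t 2 = ?t 1" using den_dvd_den[OF eqs(1)] den_dvd_den[OF eqs(2)] dvd_antisym by blast
  have d13: "?t 1 dvd ?t 3" using den_dvd_den[OF eqs(3)] .
  let ?c = "(1 / v 1 - 1) / (of_nat (?t 1) * v 2) - 1 / (of_nat (?t 1) * v 1)"
  \<comment> \<open>Since \<open>a 1\<close> is at least 1, \<open>v 1 + v 2\<close> is at most 1;
    this is the sign of the coefficient \<open>?c\<close>.\<close>
  have "1 * v 1 \<le> of_nat (a 1) * v 1" using a pos by (intro mult_right_mono) auto
  then have "v 1 + v 2 \<le> 1" using eqs(1) by simp
  moreover have "?c = (1 - v 1 - v 2) / (of_nat (?t 1) * (v 1 * v 2))"
    using pos den_pos[of "v 1"] by (simp add: field_simps)
  ultimately have c: "?c \<ge> 0" using pos by simp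
  let ?e = "(1 / v 1 - 1) * (1 / v 2 - 1) / (of_nat (?t 3) * v 3)"
  have nz: "v j \<noteq> 0" if "j \<in> {1..3}" for j using v that unfolding weights_def by force
  show ?thesis
  proof (rule layered_levelsI)
    fix m :: nat assume m: "m \<ge> 1"
    have n1: "nu (Suc 0) v m = 1 / (of_nat (?t 1) * v 1) * ind (?t 1) m - ind 1 m"
      using nu_Suc[of 0 v m] nu_0[OF m] nz[of 1] m by simp
    have s2: "{1..Suc 0} = {1}" by auto
    have "nu (Suc (Suc 0)) v m = (\<Prod>j=1..Suc 0. 1 / v j - 1) / (of_nat (den (v (Suc (Suc 0)))) * v (Suc (Suc 0)))
          * ind (den (v (Suc (Suc 0)))) m - nu (Suc 0) v m"
      by (rule nu_Suc) (use nz d12 m in \<open>auto simp: s2 numeral_2_eq_2\<close>)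
    then have n2: "nu (Suc (Suc 0)) v m = ?c * ind (?t 1) m + ind 1 m"
      unfolding n1 s2 using d12 by (simp add: numeral_2_eq_2 left_diff_distrib)
    have s3: "{1..Suc (Suc 0)} = {1, 2}" "{1..Suc (Suc (Suc 0))} = {1, 2, 3}" by auto
    have "nu (Suc (Suc (Suc 0))) v m
        = (\<Prod>j=1..Suc (Suc 0). 1 / v j - 1) / (of_nat (den (v (Suc (Suc (Suc 0))))) * v (Suc (Suc (Suc 0))))
          * ind (den (v (Suc (Suc (Suc 0))))) m - nu (Suc (Suc 0)) v m"
    proof (rule nu_Suc[OF _ _ m])
      show "v j \<noteq> 0" if "j \<in> {1..Suc (Suc (Suc 0))}" for j
        using nz[of j] that by (simp add: numeral_3_eq_3)
      fix j :: nat assume "j \<in> {1..Suc (Suc 0)}"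
      then have "j = 1 \<or> j = 2" by auto
      then show "den (v j) dvd den (v (Suc (Suc (Suc 0))))"
        using d12 d13 by (auto simp: numeral_3_eq_3)
    qed
    then show "nu 3 v m = ?e * ind (?t 3) m - ?c * ind (?t 1) m - ind 1 m"
      unfolding n2 s3 by (simp add: numeral_3_eq_3)
  next
    fix \<theta> :: rat assume "\<theta> > 0"
    then show "layered {m. m \<ge> 1 \<and> \<theta> \<le> ?e * ind (?t 3) m - ?c * ind (?t 1) m - ind 1 m}"
      using c d13 by (intro layered_type_VI den_pos)
  qed
qed

section \<open>From layered levels to the conditions on the sets M_j\<close>

lemma conditions_if_layered_levels:
  assumes w: "weights n w" and s: "bij_betw \<sigma> {1..n} {1..n}" and lev: "layered_levels n (w \<circ> \<sigma>)"
    and j: "1 \<le> j" "of_nat j \<le> nu_max n w"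
  shows "condI (Mset n w j) \<and> strong1 (Mset n w j) \<and> strong2 (Mset n w j)"
proof (rule layered_conditions)
  have nz: "w j \<noteq> 0" if "j \<in> {1..n}" for j using w that unfolding weights_def by force
  have "Mset n w j = {m. m \<ge> 1 \<and> of_nat j \<le> nu n (w \<circ> \<sigma>) m}"
    unfolding Mset_def using nu_permute[OF nz s] by auto
  then show "layered (Mset n w j)" using lev j(1) unfolding layered_levels_def by simp
  \<comment> \<open>The maximum is attained, so M_j is nonempty for every j up to it.\<close>
  have "nu_max n w \<in> {nu n w m | m. m \<ge> 1}"
    unfolding nu_max_def using finite_nu_values[of n w] nz by (intro Max_in) auto
  then show "Mset n w j \<noteq> {}" using j(2) unfolding Mset_def by auto
qed

lemma weights_permute:
  assumes "weights n w" "bij_betw \<sigma> {1..n} {1..n}"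
  shows "weights n (w \<circ> \<sigma>)"
  unfolding weights_def
proof
  fix i assume "i \<in> {1..n}"
  then have "\<sigma> i \<in> {1..n}" using bij_betwE[OF assms(2)] by blast
  then show "0 < (w \<circ> \<sigma>) i \<and> (w \<circ> \<sigma>) i < 1" using assms(1) unfolding weights_def by simp
qed

lemma up_to_perm_conditions:
  assumes "up_to_perm n w P" "weights n w"
    and "\<And>v a. weights n v \<Longrightarrow> (\<And>j. j \<in> {1..n} \<Longrightarrow> a j \<ge> 1) \<Longrightarrow> P v a \<Longrightarrow> layered_levels n v"
    and "1 \<le> j" "of_nat j \<le> nu_max n w"
  shows "condI (Mset n w j) \<and> strong1 (Mset n w j) \<and> strong2 (Mset n w j)"
proof -
  obtain \<sigma> a where s: "bij_betw \<sigma> {1..n} {1..n}" "\<And>j. j \<in> {1..n} \<Longrightarrow> a j \<ge> 1" "P (w \<circ> \<sigma>) a"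
    using assms(1) unfolding up_to_perm_def by blast
  have "layered_levels n (w \<circ> \<sigma>)" by (rule assms(3)[OF weights_permute[OF assms(2) s(1)] s(2,3)])
  then show ?thesis using conditions_if_layered_levels assms(2,4,5) s(1) by blast
qed

text \<open>In (C1) for {i} the set \<open>K\<close> has one element, necessarily the other index
  \<open>3 - i\<close>. The exponent is positive because 1 and \<open>1 - w (3 - i)\<close>
  are.\<close>

lemma C1_singleton:
  assumes "C1 2 w" "weights 2 w" "i \<in> {1, 2}"
  shows "\<exists>a\<ge>1. of_nat a * w i = 1 \<or> of_nat a * w i + w (3 - i) = 1"
proof -
  have set: "{1..2} = {1, 2::nat}" by auto
  have lt: "w (3 - i) < 1" using assms(2,3) unfolding weights_def by auto
  have sum: "wsum 2 w \<alpha> = of_nat (\<alpha> i) * w i" if "\<forall>k. k \<notin> {i} \<longrightarrow> \<alpha> k = 0" for \<alpha>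
    using that assms(3) unfolding wsum_def set by auto
  have a1: "a \<ge> 1" if "of_nat a * w i = x" "x > 0" for a x
    using that by (cases a) auto
  have "{i} \<subseteq> {1..2} \<and> {i} \<noteq> {}" using assms(3) by auto
  then have "(\<exists>\<alpha>::nat\<Rightarrow>nat. (\<forall>k. k \<notin> {i} \<longrightarrow> \<alpha> k = 0) \<and> wsum 2 w \<alpha> = 1)
    \<or> (\<exists>K. K \<subseteq> {1..2} - {i} \<and> card K = card {i} \<and>
          (\<forall>k\<in>K. \<exists>\<alpha>::nat\<Rightarrow>nat. (\<forall>l. l \<notin> {i} \<longrightarrow> \<alpha> l = 0) \<and> wsum 2 w \<alpha> = 1 - w k))"
    by (rule assms(1)[unfolded C1_def, THEN spec[of _ "{i}"], THEN mp])
  then show ?thesis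
  proof (elim disjE exE conjE)
    fix \<alpha> :: "nat \<Rightarrow> nat" assume "\<forall>k. k \<notin> {i} \<longrightarrow> \<alpha> k = 0" "wsum 2 w \<alpha> = 1"
    then have "of_nat (\<alpha> i) * w i = 1" using sum by simp
    then show ?thesis using a1[of "\<alpha> i" 1] by (intro exI[of _ "\<alpha> i"]) auto
  next
    fix K assume K: "K \<subseteq> {1..2} - {i}" "card K = card {i}"
      and ex: "\<forall>k\<in>K. \<exists>\<alpha>::nat\<Rightarrow>nat. (\<forall>l. l \<notin> {i} \<longrightarrow> \<alpha> l = 0) \<and> wsum 2 w \<alpha> = 1 - w k"
    have "K \<subseteq> {3 - i}" using K(1) assms(3) unfolding set by auto
    moreover have "K \<noteq> {}" using K(2) by auto
    ultimately have "3 - i \<in> K" by auto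
    then obtain \<alpha> :: "nat \<Rightarrow> nat" where "\<forall>l. l \<notin> {i} \<longrightarrow> \<alpha> l = 0" "wsum 2 w \<alpha> = 1 - w (3 - i)"
      using ex by blast
    then have "of_nat (\<alpha> i) * w i = 1 - w (3 - i)" using sum by simp
    then show ?thesis using a1[of "\<alpha> i" "1 - w (3 - i)"] lt by (intro exI[of _ "\<alpha> i"]) auto
  qed
qed

text \<open>(C1) on the two singletons leaves four systems: two unit fractions, a chain in either
  order, or a cycle. Swapping the variables reverses the chain.\<close>

lemma two_variables_conditions:
  assumes c1: "C1 2 w" and w: "weights 2 w" and j: "1 \<le> j" "of_nat j \<le> nu_max 2 w"
  shows "condI (Mset 2 w j) \<and> strong1 (Mset 2 w j) \<and> strong2 (Mset 2 w j)"
proof -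
  have set: "{1..2} = {1, 2::nat}" by auto
  obtain a where a: "a \<ge> 1" "of_nat a * w 1 = 1 \<or> of_nat a * w 1 + w 2 = 1"
    using C1_singleton[OF c1 w, of 1] by auto
  obtain b where b: "b \<ge> 1" "of_nat b * w 2 = 1 \<or> of_nat b * w 2 + w 1 = 1"
    using C1_singleton[OF c1 w, of 2] by auto
  let ?swap = "\<lambda>i::nat. 3 - i"
  have bij: "bij_betw (\<lambda>i. i) {1..2} {1..2::nat}" "bij_betw ?swap {1..2} {1..2}"
    unfolding bij_betw_def inj_on_def set by (simp_all add: insert_commute)
  have ww: "w = w \<circ> (\<lambda>i. i)" by auto
  consider "of_nat a * w 1 = 1" "of_nat b * w 2 = 1" | "of_nat a * w 1 = 1" "of_nat b * w 2 + w 1 = 1"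
    | "of_nat a * w 1 + w 2 = 1" "of_nat b * w 2 = 1"
    | "of_nat a * w 1 + w 2 = 1" "of_nat b * w 2 + w 1 = 1"
    using a(2) b(2) by blast
  then have "layered_levels 2 w \<or> layered_levels 2 (w \<circ> ?swap)"
  proof cases
    case 1
    then show ?thesis using fermat_layered_levels[OF w] by blast
  next
    case 2
    have "layered_levels 2 w"
      by (rule chain_layered_levels[OF w, of "\<lambda>i. if i = 1 then a else b"]) (use 2 a(1) b(1) in auto)
    then show ?thesis ..
  next
    case 3
    have "layered_levels 2 (w \<circ> ?swap)"
      by (rule chain_layered_levels[OF weights_permute[OF w bij(2)], of "\<lambda>i. if i = 1 then b else a"])
        (use 3 a(1) b(1) in \<open>auto simp: numeral_2_eq_2 numeral_3_eq_3\<close>)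
    then show ?thesis ..
  next
    case 4
    have "layered_levels 2 w"
      by (rule cycle_layered_levels[OF _ w, of "\<lambda>i. if i = 1 then a else b"]) (use 4 set in auto)
    then show ?thesis ..
  qed
  then show ?thesis
    using conditions_if_layered_levels[OF w bij(1) _ j] conditions_if_layered_levels[OF w bij(2) _ j] ww
    by auto
qed

theorem theorem6p9:
  fixes n :: nat and w :: "nat \<Rightarrow> rat"
  assumes ws: "weight_system n w"
    and c1: "C1 n w"
    and types: "cycle_type n w \<or> chain_type n w \<or> n = 2 \<or>
                (n = 3 \<and> (typeIII w \<or> typeIV w \<or> typeV w \<or> typeVI w \<or> typeVII w))"
  shows "\<forall>j::nat. 1 \<le> j \<and> of_nat j \<le> nu_max n w \<longrightarrow>
           condI (Mset n w j) \<and> strong1 (Mset n w j) \<and> strong2 (Mset n w j)"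
proof (intro allI impI)
  fix j :: nat assume "1 \<le> j \<and> of_nat j \<le> nu_max n w"
  then have j: "1 \<le> j" "of_nat j \<le> nu_max n w" by auto
  have n: "n \<ge> 1" and w: "weights n w" using ws unfolding weight_system_def weights_def by auto
  \<comment> \<open>Types V and VII are the chain and cycle types in three variables and fall under
    the first two cases.\<close>
  consider "cycle_type n w" | "chain_type n w" | "n = 2" | "n = 3" "typeIII w" | "n = 3" "typeIV w"
    | "n = 3" "typeVI w"
    using types unfolding typeV_def typeVII_def by blast
  then show "condI (Mset n w j) \<and> strong1 (Mset n w j) \<and> strong2 (Mset n w j)"
  proof cases
    case 1
    show ?thesis
    proof (rule up_to_perm_conditions[OF 1[unfolded cycle_type_def] w _ j])
      fix v and a :: "nat \<Rightarrow> nat"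
      assume "weights n v" "\<forall>j\<in>{1..n}. of_nat (a j) * v j + v (if j = 1 then n else j - 1) = 1"
      then show "layered_levels n v" by (intro cycle_layered_levels[of n v a] n) blast+
    qed
  next
    case 2
    show ?thesis
    proof (rule up_to_perm_conditions[OF 2[unfolded chain_type_def] w _ j])
      fix v and a :: "nat \<Rightarrow> nat"
      assume "weights n v" "\<And>j. j \<in> {1..n} \<Longrightarrow> a j \<ge> 1"
        "of_nat (a 1) * v 1 = 1 \<and> (\<forall>j\<in>{2..n}. of_nat (a j) * v j + v (j - 1) = 1)"
      then show "layered_levels n v" by (intro chain_layered_levels[of n v a]) blast+
    qed
  next
    case 3
    then show ?thesis using two_variables_conditions c1 w j by simp
  next
    case 4
    then have w3: "weights 3 w" and j3: "of_nat j \<le> nu_max 3 w" using w j by auto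
    show ?thesis unfolding 4(1)
    proof (rule up_to_perm_conditions[OF 4(2)[unfolded typeIII_def] w3 _ j(1) j3])
      fix v and a :: "nat \<Rightarrow> nat"
      assume "weights 3 v" "\<And>j. j \<in> {1..3} \<Longrightarrow> a j \<ge> 1" "of_nat (a 1) * v 1 = 1 \<and> of_nat (a 2) * v 2 + v 1 = 1 \<and> of_nat (a 3) * v 3 + v 1 = 1"
      then show "layered_levels 3 v" by (intro type_III_layered_levels[of v a]) auto
    qed
  next
    case 5
    then have w3: "weights 3 w" and j3: "of_nat j \<le> nu_max 3 w" using w j by auto
    show ?thesis unfolding 5(1)
    proof (rule up_to_perm_conditions[OF 5(2)[unfolded typeIV_def] w3 _ j(1) j3])
      fix v and a :: "nat \<Rightarrow> nat"
      assume "weights 3 v" "\<And>j. j \<in> {1..3} \<Longrightarrow> a j \<ge> 1" "of_nat (a 1) * v 1 = 1 \<and> of_nat (a 2) * v 2 + v 3 = 1 \<and> of_nat (a 3) * v 3 + v 2 = 1"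
      then show "layered_levels 3 v" by (intro type_IV_layered_levels[of v a]) auto
    qed
  next
    case 6
    then have w3: "weights 3 w" and j3: "of_nat j \<le> nu_max 3 w" using w j by auto
    show ?thesis unfolding 6(1)
    proof (rule up_to_perm_conditions[OF 6(2)[unfolded typeVI_def] w3 _ j(1) j3])
      fix v and a :: "nat \<Rightarrow> nat"
      assume "weights 3 v" "\<And>j. j \<in> {1..3} \<Longrightarrow> a j \<ge> 1" "of_nat (a 1) * v 1 + v 2 = 1 \<and> of_nat (a 2) * v 2 + v 1 = 1 \<and> of_nat (a 3) * v 3 + v 1 = 1"
      then show "layered_levels 3 v" by (intro type_VI_layered_levels[of v a]) auto
    qed
  qed
qed

end
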